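(* Let $(K,\tau)$ be a field with a local W-topology $\tau$. Then: (1) $\tau$ has a unique V-topological coarsening; (2) if $K^*$ is an "ultrapower" of $K$ and $R=R_\tau\subseteq K^*$ is the ring induced by $\tau$, then the integral closure $\widetilde{R}$ of $R$ in $\operatorname{Frac}(R)=K^*$ is a valuation ring.
   Context: Let $K$ be a field. A topology on $K$ here always means a Hausdorff, non-discrete, locally bounded ring topology on $K$ (a set $B\subseteq K$ is bounded if for every neighborhood $U$ of $0$ there is a neighborhood $V$ of $0$ with $V\cdot B\subseteq U$; locally bounded means some neighborhood of $0$ is bounded). A topology $\sigma$ is a coarsening of $\tau$ if every $\sigma$-open set is $\tau$-open. A V-topology is a field topology induced by a non-trivial valuation or absolute value. A subset $S\subseteq K$ is a $W_n$-set if for all $x_0,\ldots,x_n\in K$ there is $i$ with $x_i\in\sum_{j\neq i}S\cdot x_j=\{\sum_{j\ne i}s_jx_j : s_j\in S\}$. A topology $\tau$ is a $W_n$-topology if some $\tau$-bounded set is a $W_n$-set; a W-topology is a $W_n$-topology for some finite $n$. A W-topology $\tau$ is local if for every $\tau$-bounded $B\subseteq K$ there is a $\tau$-bounded $C\subseteq K$ such that for all $x\in B$, $1/x\in C$ or $1/(1-x)\in C$. An "ultrapower" $K^*$ of $K$ is a monster model (sufficiently saturated and homogeneous elementary extension) of the theory of $K$ expanded by a unary predicate for every subset of $K$; for $U\subseteq K$, $U^*$ is the interpretation in $K^*$ of the predicate for $U$. The ring induced by $\tau$ is $R_\tau=\bigcup\{B^* : B\subseteq K\ \tau\text{-bounded}\}$,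 a subring of $K^*$ with fraction field $K^*$. *)

theory Defs
  imports
    "HOL-Analysis.T1_Spaces"
    "HOL-Algebra.Group"
    "HOL-Computational_Algebra.Polynomial"
begin

unbundle cardinal_syntax

section \<open>Locally bounded ring topologies on a field\<close>

definition nbhd_zero :: "'k::field topology \<Rightarrow> 'k set \<Rightarrow> bool" where
  "nbhd_zero \<tau> U \<longleftrightarrow> (\<exists>V. openin \<tau> V \<and> 0 \<in> V \<and> V \<subseteq> U)"

definition bounded_in :: "'k::field topology \<Rightarrow> 'k set \<Rightarrow> bool" where
  "bounded_in \<tau> B \<longleftrightarrow>
     (\<forall>U. nbhd_zero \<tau> U \<longrightarrow> (\<exists>V. nbhd_zero \<tau> V \<and> {v * b | v b. v \<in> V \<and> b \<in> B} \<subseteq> U))"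

definition ring_topology :: "'k::field topology \<Rightarrow> bool" where
  "ring_topology \<tau> \<longleftrightarrow>
     topspace \<tau> = UNIV \<and>
     continuous_map (prod_topology \<tau> \<tau>) \<tau> (\<lambda>(x, y). x + y) \<and>
     continuous_map \<tau> \<tau> uminus \<and>
     continuous_map (prod_topology \<tau> \<tau>) \<tau> (\<lambda>(x, y). x * y)"

text \<open>The standing meaning of ``a topology on the field'': Hausdorff, non-discrete,
  locally bounded, ring topology.\<close>

definition lb_ring_topology :: "'k::field topology \<Rightarrow> bool" where
  "lb_ring_topology \<tau> \<longleftrightarrow>
     ring_topology \<tau> \<and> Hausdorff_space \<tau> \<and> \<tau> \<noteq> discrete_topology UNIV \<and>
     (\<exists>U. nbhd_zero \<tau> U \<and> bounded_in \<tau> U)"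

definition field_topology :: "'k::field topology \<Rightarrow> bool" where
  "field_topology \<tau> \<longleftrightarrow>
     lb_ring_topology \<tau> \<and> continuous_map (subtopology \<tau> (UNIV - {0})) \<tau> inverse"

definition coarsening :: "'k topology \<Rightarrow> 'k topology \<Rightarrow> bool" where
  "coarsening \<sigma> \<tau> \<longleftrightarrow> (\<forall>U. openin \<sigma> U \<longrightarrow> openin \<tau> U)"


section \<open>V-topologies\<close>

definition ordered_abelian_group :: "'g monoid \<Rightarrow> ('g \<times> 'g) set \<Rightarrow> bool" where
  "ordered_abelian_group G r \<longleftrightarrow>
     comm_group G \<and> linear_order_on (carrier G) r \<and>
     (\<forall>a\<in>carrier G. \<forall>b\<in>carrier G. \<forall>c\<in>carrier G.
        (a, b) \<in> r \<longrightarrow> (a \<otimes>\<^bsub>G\<^esub> c, b \<otimes>\<^bsub>G\<^esub> c) \<in> r)"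

text \<open>A valuation \<open>v\<close> with value group \<open>G\<close>, in additive (Krull) order convention:
  \<open>(a, b) \<in> r\<close> means \<open>a \<le> b\<close>, and large values are close to zero. The value \<open>v 0 = \<infinity>\<close> is
  not represented; \<open>v\<close> is only constrained on nonzero elements. The map is required to be onto,
  so that \<open>G\<close> is the value group itself and not a larger group containing it.\<close>

definition valuation ::
    "'g monoid \<Rightarrow> ('g \<times> 'g) set \<Rightarrow> ('k::field \<Rightarrow> 'g) \<Rightarrow> bool" where
  "valuation G r v \<longleftrightarrow>
     ordered_abelian_group G r \<and>
     v ` (UNIV - {0}) = carrier G \<and>
     (\<forall>x y. x \<noteq> 0 \<longrightarrow> y \<noteq> 0 \<longrightarrow> v (x * y) = v x \<otimes>\<^bsub>G\<^esub> v y) \<and>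
     (\<forall>x y. x \<noteq> 0 \<longrightarrow> y \<noteq> 0 \<longrightarrow> x + y \<noteq> 0 \<longrightarrow>
        (v x, v (x + y)) \<in> r \<or> (v y, v (x + y)) \<in> r)"

definition nontrivial_valuation ::
    "'g monoid \<Rightarrow> ('g \<times> 'g) set \<Rightarrow> ('k::field \<Rightarrow> 'g) \<Rightarrow> bool" where
  "nontrivial_valuation G r v \<longleftrightarrow> valuation G r v \<and> (\<exists>x. x \<noteq> 0 \<and> v x \<noteq> \<one>\<^bsub>G\<^esub>)"

definition valuation_ball ::
    "('g \<times> 'g) set \<Rightarrow> ('k::field \<Rightarrow> 'g) \<Rightarrow> 'k \<Rightarrow> 'g \<Rightarrow> 'k set" where
  "valuation_ball r v x \<gamma> = {y. y = x \<or> ((\<gamma>, v (y - x)) \<in> r \<and> \<gamma> \<noteq> v (y - x))}"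

definition induced_by_valuation ::
    "'g monoid \<Rightarrow> ('g \<times> 'g) set \<Rightarrow> ('k::field \<Rightarrow> 'g) \<Rightarrow> 'k topology \<Rightarrow> bool" where
  "induced_by_valuation G r v \<sigma> \<longleftrightarrow>
     (\<forall>U. openin \<sigma> U \<longleftrightarrow> (\<forall>x\<in>U. \<exists>\<gamma>\<in>carrier G. valuation_ball r v x \<gamma> \<subseteq> U))"

definition absolute_value :: "('k::field \<Rightarrow> real) \<Rightarrow> bool" where
  "absolute_value a \<longleftrightarrow>
     (\<forall>x. a x \<ge> 0) \<and> (\<forall>x. a x = 0 \<longleftrightarrow> x = 0) \<and>
     (\<forall>x y. a (x * y) = a x * a y) \<and> (\<forall>x y. a (x + y) \<le> a x + a y)"

definition nontrivial_absolute_value :: "('k::field \<Rightarrow> real) \<Rightarrow> bool" where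
  "nontrivial_absolute_value a \<longleftrightarrow> absolute_value a \<and> (\<exists>x. x \<noteq> 0 \<and> a x \<noteq> 1)"

definition induced_by_absolute_value :: "('k::field \<Rightarrow> real) \<Rightarrow> 'k topology \<Rightarrow> bool" where
  "induced_by_absolute_value a \<sigma> \<longleftrightarrow>
     (\<forall>U. openin \<sigma> U \<longleftrightarrow> (\<forall>x\<in>U. \<exists>\<epsilon>>0. {y. a (y - x) < \<epsilon>} \<subseteq> U))"

text \<open>HOL cannot quantify over the type of the value group. Taking its elements to be of type
  \<^typ>\<open>'k set\<close> loses nothing: the value group is a quotient of the multiplicative group of
  the field, hence isomorphic to a group of cosets.\<close>

definition V_topology :: "'k::field topology \<Rightarrow> bool" where
  "V_topology \<sigma> \<longleftrightarrow>
     field_topology \<sigma> \<and>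
     ((\<exists>(G :: 'k set monoid) r v. nontrivial_valuation G r v \<and> induced_by_valuation G r v \<sigma>) \<or>
      (\<exists>a. nontrivial_absolute_value a \<and> induced_by_absolute_value a \<sigma>))"


section \<open>W-topologies\<close>

definition W_set :: "nat \<Rightarrow> 'k::field set \<Rightarrow> bool" where
  "W_set n S \<longleftrightarrow>
     (\<forall>x :: nat \<Rightarrow> 'k. \<exists>i\<le>n. x i \<in> {\<Sum>j\<in>{..n} - {i}. s j * x j | s. \<forall>j\<in>{..n} - {i}. s j \<in> S})"

definition W_n_topology :: "nat \<Rightarrow> 'k::field topology \<Rightarrow> bool" where
  "W_n_topology n \<tau> \<longleftrightarrow> lb_ring_topology \<tau> \<and> (\<exists>S. bounded_in \<tau> S \<and> W_set n S)"

definition W_topology :: "'k::field topology \<Rightarrow> bool" where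
  "W_topology \<tau> \<longleftrightarrow> (\<exists>n. W_n_topology n \<tau>)"

text \<open>The guards keep the convention \<open>1 / 0 = 0\<close> out of the definition.\<close>

definition local_W_topology :: "'k::field topology \<Rightarrow> bool" where
  "local_W_topology \<tau> \<longleftrightarrow>
     W_topology \<tau> \<and>
     (\<forall>B. bounded_in \<tau> B \<longrightarrow>
        (\<exists>C. bounded_in \<tau> C \<and>
           (\<forall>x\<in>B. (x \<noteq> 0 \<and> 1 / x \<in> C) \<or> (1 - x \<noteq> 0 \<and> 1 / (1 - x) \<in> C))))"


section \<open>First-order logic of rings with unary predicates\<close>

datatype rterm =
    TVar nat | TZero | TOne
  | TPlus rterm rterm | TMinus rterm rterm | TTimes rterm rterm

datatype 'p formula =
    FEq rterm rterm | FPred 'p rterm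
  | FNot "'p formula" | FAnd "'p formula" "'p formula" | FEx nat "'p formula"

primrec rterm_eval :: "(nat \<Rightarrow> 'a::field) \<Rightarrow> rterm \<Rightarrow> 'a" where
  "rterm_eval e (TVar n) = e n"
| "rterm_eval e TZero = 0"
| "rterm_eval e TOne = 1"
| "rterm_eval e (TPlus s t) = rterm_eval e s + rterm_eval e t"
| "rterm_eval e (TMinus s t) = rterm_eval e s - rterm_eval e t"
| "rterm_eval e (TTimes s t) = rterm_eval e s * rterm_eval e t"

text \<open>Truth in the field \<open>'a\<close>, expanded by the interpretation \<open>P\<close> of the predicate symbols.\<close>

primrec holds :: "('p \<Rightarrow> 'a::field set) \<Rightarrow> (nat \<Rightarrow> 'a) \<Rightarrow> 'p formula \<Rightarrow> bool" where
  "holds P e (FEq s t) \<longleftrightarrow> rterm_eval e s = rterm_eval e t"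
| "holds P e (FPred U t) \<longleftrightarrow> rterm_eval e t \<in> P U"
| "holds P e (FNot \<phi>) \<longleftrightarrow> \<not> holds P e \<phi>"
| "holds P e (FAnd \<phi> \<psi>) \<longleftrightarrow> holds P e \<phi> \<and> holds P e \<psi>"
| "holds P e (FEx n \<phi>) \<longleftrightarrow> (\<exists>a. holds P (e(n := a)) \<phi>)"

definition elementary_embedding ::
    "('p \<Rightarrow> 'a::field set) \<Rightarrow> ('p \<Rightarrow> 'b::field set) \<Rightarrow> ('a \<Rightarrow> 'b) \<Rightarrow> bool" where
  "elementary_embedding P Q \<iota> \<longleftrightarrow> (\<forall>\<phi> e. holds P e \<phi> \<longleftrightarrow> holds Q (\<iota> \<circ> e) \<phi>)"

text \<open>A 1-type over \<open>A\<close> is given as a set of formulas, each with an assignment of parameters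
  from \<open>A\<close> to its variables other than variable 0, which is the variable of the type. For empty
  \<open>A\<close> there are no such assignments; this is harmless, since a type over the empty set is
  also one over \<open>{0}\<close>.\<close>

definition saturated :: "'c rel \<Rightarrow> ('p \<Rightarrow> 'a::field set) \<Rightarrow> bool" where
  "saturated \<kappa> P \<longleftrightarrow>
     (\<forall>(A :: 'a set) (p :: ('p formula \<times> (nat \<Rightarrow> 'a)) set).
        |A| <o \<kappa> \<longrightarrow> (\<forall>(\<phi>, e)\<in>p. range e \<subseteq> A) \<longrightarrow>
        (\<forall>q. q \<subseteq> p \<longrightarrow> finite q \<longrightarrow> (\<exists>a. \<forall>(\<phi>, e)\<in>q. holds P (e(0 := a)) \<phi>)) \<longrightarrow>
        (\<exists>a. \<forall>(\<phi>, e)\<in>p. holds P (e(0 := a)) \<phi>))"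

definition partial_elementary :: "('p \<Rightarrow> 'a::field set) \<Rightarrow> 'a set \<Rightarrow> ('a \<Rightarrow> 'a) \<Rightarrow> bool" where
  "partial_elementary P A f \<longleftrightarrow>
     (\<forall>\<phi> e. range e \<subseteq> A \<longrightarrow> (holds P e \<phi> \<longleftrightarrow> holds P (f \<circ> e) \<phi>))"

definition automorphism :: "('p \<Rightarrow> 'a::field set) \<Rightarrow> ('a \<Rightarrow> 'a) \<Rightarrow> bool" where
  "automorphism P g \<longleftrightarrow>
     bij g \<and> g 0 = 0 \<and> g 1 = 1 \<and>
     (\<forall>x y. g (x + y) = g x + g y) \<and> (\<forall>x y. g (x - y) = g x - g y) \<and>
     (\<forall>x y. g (x * y) = g x * g y) \<and>
     (\<forall>U x. g x \<in> P U \<longleftrightarrow> x \<in> P U)"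

definition strongly_homogeneous :: "'c rel \<Rightarrow> ('p \<Rightarrow> 'a::field set) \<Rightarrow> bool" where
  "strongly_homogeneous \<kappa> P \<longleftrightarrow>
     (\<forall>(A :: 'a set) f. |A| <o \<kappa> \<longrightarrow> partial_elementary P A f \<longrightarrow>
        (\<exists>g. automorphism P g \<and> (\<forall>a\<in>A. g a = f a)))"

text \<open>The structure on the field \<open>'m\<close> that interprets the predicate of \<open>U\<close> as \<open>star U\<close>
  is a monster model extending the full expansion of \<open>'k\<close>, elementarily embedded by \<open>\<iota>\<close>.
  ``Sufficiently'' saturated and homogeneous is read as: for some cardinal \<open>\<kappa>\<close> above
  the number of subsets of \<open>'k\<close>, that is, above the size of the language.\<close>

definition monster_extension ::
    "'c rel \<Rightarrow> ('k::field \<Rightarrow> 'm::field) \<Rightarrow> ('k set \<Rightarrow> 'm set) \<Rightarrow> bool" where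
  "monster_extension \<kappa> \<iota> star \<longleftrightarrow>
     Card_order \<kappa> \<and> |UNIV :: 'k set set| <o \<kappa> \<and>
     elementary_embedding (\<lambda>U. U) star \<iota> \<and>
     saturated \<kappa> star \<and> strongly_homogeneous \<kappa> star"

definition induced_ring :: "'k::field topology \<Rightarrow> ('k set \<Rightarrow> 'm set) \<Rightarrow> 'm set" where
  "induced_ring \<tau> star = \<Union> {star B | B. bounded_in \<tau> B}"


section \<open>Fraction field, integral closure and valuation rings inside a field\<close>

definition fractions :: "'m::field set \<Rightarrow> 'm set" where
  "fractions R = {a / b | a b. a \<in> R \<and> b \<in> R \<and> b \<noteq> 0}"

definition integral_closure_in :: "'m::field set \<Rightarrow> 'm set \<Rightarrow> 'm set" where
  "integral_closure_in L R =
     {x \<in> L. \<exists>p. lead_coeff p = 1 \<and> (\<forall>i. coeff p i \<in> R) \<and> poly p x = 0}"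

definition subring_of_field :: "'m::field set \<Rightarrow> bool" where
  "subring_of_field V \<longleftrightarrow>
     0 \<in> V \<and> 1 \<in> V \<and> (\<forall>x\<in>V. \<forall>y\<in>V. x + y \<in> V \<and> x - y \<in> V \<and> x * y \<in> V)"

text \<open>A valuation ring whose fraction field is all of \<open>'m\<close>.\<close>

definition valuation_ring :: "'m::field set \<Rightarrow> bool" where
  "valuation_ring V \<longleftrightarrow> subring_of_field V \<and> (\<forall>x. x \<noteq> 0 \<longrightarrow> x \<in> V \<or> inverse x \<in> V)"

end

theory Submission
  imports Defs "HOL-Library.Set_Algebras"
begin

text \<open>A locally bounded ring topology is given by one bounded neighbourhood \<open>A\<close> of zero: the sets
  \<open>c A\<close> are a base of neighbourhoods, and the bounded sets are the subsets of the \<open>c A\<close>.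

  Let \<open>\<tau>\<close> be local with a bounded \<open>W\<^sub>n\<close>-set. If \<open>x\<close> runs through a bounded set and \<open>1/x\<close> stays outside a
  large bounded set, then \<open>x\<^sup>n\<close> is small; so, on bounded sets, \<open>x\<^sup>n\<close> being small means that \<open>x\<close> is almost
  a non-unit, a condition closed under sums by locality. Let \<open>thick B\<close> consist of the
  elements \<open>e\<close> that have, for every neighbourhood \<open>U\<close>, some \<open>s \<in> B\<close> with \<open>(e - s)\<^sup>n \<in> U\<close>. A minimal
  number of elements that are always dependent modulo such errors yields a bounded \<open>B\<close> such that
  \<open>thick B\<close> contains \<open>e\<close> or \<open>1/e\<close> for every \<open>e\<close>. Hence the multiples of \<open>thick B\<close> form the
  neighbourhoods of zero of a V-topology (Kowalsky and Duerbaum), and every V-topological coarsening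
  agrees with it. The elements of \<open>thick B\<close> being roots of \<open>(X - s)\<^sup>n - u\<close> with \<open>s\<close>, \<open>u\<close> bounded, the valuation ring
  that it induces in the elementary extension is integral over \<open>R\<close>.\<close>

section \<open>Bounded sets and neighbourhoods of zero\<close>


text \<open>In terms of the induced ring \<open>R\<close>, locality of the topology says that
  \<open>R\<close> is a local ring. A non-unit of \<open>R\<close> need not be infinitesimal, but
  its \<open>n\<close>-th power is; this is why errors are measured by \<open>(e - s) ^ n\<close>
  and not by \<open>e - s\<close>. The obstacle is uniformity: one bounded set must serve every
  \<open>e\<close>, however large \<open>e\<close> or \<open>1/e\<close> is. Hence
  \<open>thick\<close> lets the approximant depend on the neighbourhood, and only the set of
  approximants is fixed. Minimality of the number of dependent elements supplies a tuple without
  approximate dependence. Each residue in it then has an inverse in one bounded set, and a relation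
  that involves \<open>e\<close> can be divided by it. Uniqueness rests on the same powers: a
  product-closed ball of a V-topology contains \<open>x\<close> as soon as it contains
  \<open>x ^ n\<close>, so it absorbs all these errors.\<close>

locale lb_ball =
  fixes A :: "'k::field set"
  assumes zero_mem: "0 \<in> A"
    and one_mem: "1 \<in> A"
    and neg_mem: "a \<in> A \<Longrightarrow> - a \<in> A"
    and add_ball: "\<exists>d. d \<noteq> 0 \<and> (\<forall>a\<in>A. \<forall>b\<in>A. d * (a + b) \<in> A)"
    and mult_ball: "\<exists>d. d \<noteq> 0 \<and> (\<forall>a\<in>A. \<forall>b\<in>A. d * (a * b) \<in> A)"
    and dir_ball: "\<exists>d. d \<noteq> 0 \<and> (\<forall>a\<in>A. d * a \<in> A \<and> d * a * c \<in> A)"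
    and sep_ball: "x \<noteq> 0 \<Longrightarrow> \<exists>c. c \<noteq> 0 \<and> c * x \<notin> A"
begin

definition nb :: "'k set \<Rightarrow> bool" where
  "nb U \<longleftrightarrow> (\<exists>c. c \<noteq> 0 \<and> (\<forall>a\<in>A. c * a \<in> U))"

definition bd :: "'k set \<Rightarrow> bool" where
  "bd X \<longleftrightarrow> (\<exists>c. c \<noteq> 0 \<and> (\<forall>x\<in>X. c * x \<in> A))"

lemma nb_mono: "nb U \<Longrightarrow> U \<subseteq> V \<Longrightarrow> nb V"
  unfolding nb_def by blast

lemma nb_zero: "nb U \<Longrightarrow> 0 \<in> U"
  unfolding nb_def using zero_mem by force

lemma nb_nonzero: "nb U \<Longrightarrow> \<exists>u\<in>U. u \<noteq> 0"
  unfolding nb_def using one_mem by force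

text \<open>The multiples of \<open>A\<close> need not be nested; \<open>dir_ball\<close> at the
  ratio \<open>c / e\<close> provides one multiple inside both \<open>c A\<close> and
  \<open>e A\<close>.\<close>

lemma nb_Int:
  assumes "nb U" "nb V" shows "nb (U \<inter> V)"
proof -
  obtain c where c: "c \<noteq> 0" "\<forall>a\<in>A. c * a \<in> U" using assms(1) unfolding nb_def by blast
  obtain e where e: "e \<noteq> 0" "\<forall>a\<in>A. e * a \<in> V" using assms(2) unfolding nb_def by blast
  obtain d where d: "d \<noteq> 0" "\<forall>a\<in>A. d * a \<in> A \<and> d * a * (c / e) \<in> A"
    using dir_ball by blast
  have "c * d * a \<in> U \<inter> V" if "a \<in> A" for a
  proof -
    have "c * (d * a) \<in> U" "e * (d * a * (c / e)) \<in> V" using c e d that by blast+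
    moreover have "e * (d * a * (c / e)) = c * (d * a)" using e by simp
    ultimately show ?thesis by (simp add: mult.assoc)
  qed
  moreover have "c * d \<noteq> 0" using c d by simp
  ultimately show ?thesis unfolding nb_def by blast
qed

lemma nb_INT: "finite I \<Longrightarrow> (\<And>i. i \<in> I \<Longrightarrow> nb (U i)) \<Longrightarrow> nb (\<Inter>i\<in>I. U i)"
proof (induction I rule: finite_induct)
  case empty
  show ?case unfolding nb_def by (auto intro: exI[of _ 1])
next
  case (insert i I)
  then show ?case by (auto intro: nb_Int)
qed

lemma nb_ball: "c \<noteq> 0 \<Longrightarrow> nb ((*) c ` A)"
  unfolding nb_def by blast

lemma bd_subset: "bd Y \<Longrightarrow> X \<subseteq> Y \<Longrightarrow> bd X"
  unfolding bd_def by blast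

lemma bd_ball: "bd ((*) c ` A)"
proof (cases "c = 0")
  case True
  then show ?thesis unfolding bd_def using zero_mem by (auto intro!: exI[of _ 1])
next
  case False
  then show ?thesis unfolding bd_def by (intro exI[of _ "inverse c"]) (auto simp flip: mult.assoc)
qed

lemma bd_iff_ball: "bd X \<longleftrightarrow> (\<exists>c. c \<noteq> 0 \<and> X \<subseteq> (*) c ` A)"
proof
  assume "bd X"
  then obtain c where c: "c \<noteq> 0" "\<forall>x\<in>X. c * x \<in> A" unfolding bd_def by blast
  have "X \<subseteq> (*) (inverse c) ` A"
  proof
    fix x assume "x \<in> X"
    then have "c * x \<in> A" using c by blast
    moreover have "x = inverse c * (c * x)" using c by simp
    ultimately show "x \<in> (*) (inverse c) ` A" by blast
  qed
  then show "\<exists>c. c \<noteq> 0 \<and> X \<subseteq> (*) c ` A" using c by (meson inverse_nonzero_iff_nonzero)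
next
  assume "\<exists>c. c \<noteq> 0 \<and> X \<subseteq> (*) c ` A"
  then show "bd X" using bd_ball bd_subset by blast
qed

lemma nb_mult:
  assumes "nb U" "bd X" shows "\<exists>V. nb V \<and> (\<forall>v\<in>V. \<forall>x\<in>X. v * x \<in> U)"
proof -
  obtain c where c: "c \<noteq> 0" "\<forall>a\<in>A. c * a \<in> U" using assms(1) unfolding nb_def by blast
  obtain e where e: "e \<noteq> 0" "\<forall>x\<in>X. e * x \<in> A" using assms(2) unfolding bd_def by blast
  obtain d where d: "d \<noteq> 0" "\<forall>a\<in>A. \<forall>b\<in>A. d * (a * b) \<in> A" using mult_ball by blast
  have "v * x \<in> U" if v: "v \<in> (*) (c * d * e) ` A" and x: "x \<in> X" for v x
  proof -
    obtain a where a: "a \<in> A" "v = c * d * e * a" using v by blast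
    have "c * (d * (a * (e * x))) \<in> U" using a e c d x by blast
    then show ?thesis using a by (simp add: algebra_simps)
  qed
  then show ?thesis using nb_ball[of "c * d * e"] c d e by (metis mult_eq_0_iff)
qed

lemma nb_plus:
  assumes "nb U" shows "\<exists>V. nb V \<and> (\<forall>v\<in>V. \<forall>w\<in>V. v + w \<in> U)"
proof -
  obtain c where c: "c \<noteq> 0" "\<forall>a\<in>A. c * a \<in> U" using assms(1) unfolding nb_def by blast
  obtain d where d: "d \<noteq> 0" "\<forall>a\<in>A. \<forall>b\<in>A. d * (a + b) \<in> A" using add_ball by blast
  have "v + w \<in> U" if v: "v \<in> (*) (c * d) ` A" and w: "w \<in> (*) (c * d) ` A" for v w
  proof -
    obtain a b where a: "a \<in> A" "v = c * d * a" "b \<in> A" "w = c * d * b" using v w by blast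
    have "c * (d * (a + b)) \<in> U" using a c d by blast
    then show ?thesis using a by (simp add: algebra_simps)
  qed
  then show ?thesis using nb_ball[of "c * d"] c d by (metis mult_eq_0_iff)
qed

lemma scale_into: 
  assumes "nb U" "bd X" shows "\<exists>c. c \<noteq> 0 \<and> (\<forall>x\<in>X. c * x \<in> U)"
  using nb_mult[OF assms] nb_nonzero by blast

lemma nb_A: "nb A"
  unfolding nb_def by (auto intro: exI[of _ 1])

lemma bd_A: "bd A"
  unfolding bd_def by (auto intro: exI[of _ 1])

lemma nb_scale: 
  assumes "nb U" "c \<noteq> 0" shows "nb {x. c * x \<in> U}"
proof -
  obtain d where d: "d \<noteq> 0" "\<forall>a\<in>A. d * a \<in> U" using assms(1) unfolding nb_def by blast
  show ?thesis unfolding nb_def using d assms(2)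
    by (intro exI[of _ "d / c"]) auto
qed

lemma bd_singleton: "bd {c}"
proof -
  obtain d where "d \<noteq> 0" "\<forall>a\<in>A. d * a \<in> A \<and> d * a * c \<in> A" using dir_ball by blast
  then have "d * c \<in> A" using one_mem by force
  then show ?thesis unfolding bd_def using \<open>d \<noteq> 0\<close> by blast
qed

lemma bd_Un:
  assumes "bd X" "bd Y" shows "bd (X \<union> Y)"
proof -
  obtain c where c: "c \<noteq> 0" "\<forall>a\<in>X. c * a \<in> A" using assms(1) unfolding bd_def by blast
  obtain e where e: "e \<noteq> 0" "\<forall>a\<in>Y. e * a \<in> A" using assms(2) unfolding bd_def by blast
  obtain d where d: "d \<noteq> 0" "\<forall>a\<in>A. d * a \<in> A \<and> d * a * (c / e) \<in> A"
    using dir_ball by blast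
  have "(c * d) * a \<in> A" if "a \<in> X \<union> Y" for a
  proof (cases "a \<in> X")
    case True
    then have "d * (c * a) \<in> A" using c d by blast
    then show ?thesis by (simp add: algebra_simps)
  next
    case False
    then have "d * (e * a) * (c / e) \<in> A" using e d that by blast
    then show ?thesis using e by (simp add: algebra_simps)
  qed
  then show ?thesis using c d unfolding bd_def by (metis mult_eq_0_iff)
qed

lemma bd_insert: "bd X \<Longrightarrow> bd (insert c X)"
  using bd_Un[OF bd_singleton, of X c] by simp

lemma bd_UN: "finite I \<Longrightarrow> (\<And>i. i \<in> I \<Longrightarrow> bd (X i)) \<Longrightarrow> bd (\<Union>i\<in>I. X i)"
proof (induction I rule: finite_induct)
  case empty
  show ?case unfolding bd_def by (auto intro: exI[of _ 1])
next
  case (insert i I)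
  then show ?case by (auto intro: bd_Un)
qed

lemma bd_times:
  assumes "bd X" "bd Y" shows "bd (X * Y)"
proof -
  obtain V where V: "nb V" "\<forall>v\<in>V. \<forall>y\<in>Y. v * y \<in> A" using nb_mult[OF nb_A assms(2)] by blast
  obtain c where c: "c \<noteq> 0" "\<forall>x\<in>X. c * x \<in> V" using scale_into[OF V(1) assms(1)] by blast
  have "c * z \<in> A" if "z \<in> X * Y" for z
    using that V c by (auto elim!: set_times_elim simp flip: mult.assoc)
  then show ?thesis unfolding bd_def using c by blast
qed

lemma bd_plus:
  assumes "bd X" "bd Y" shows "bd (X + Y)"
proof -
  obtain V where V: "nb V" "\<forall>v\<in>V. \<forall>w\<in>V. v + w \<in> A" using nb_plus[OF nb_A] by blast
  obtain c where c: "c \<noteq> 0" "\<forall>x\<in>X \<union> Y. c * x \<in> V"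
    using scale_into[OF V(1) bd_Un[OF assms]] by blast
  have "c * z \<in> A" if "z \<in> X + Y" for z
    using that V c by (auto elim!: set_plus_elim simp: distrib_left)
  then show ?thesis unfolding bd_def using c by blast
qed

lemma bd_uminus: "bd X \<Longrightarrow> bd (uminus ` X)"
  unfolding bd_def using neg_mem by (metis imageE mult_minus_right)

lemma bd_diff:
  assumes "bd X" "bd Y" shows "bd {x - y | x y. x \<in> X \<and> y \<in> Y}"
proof -
  have "{x - y | x y. x \<in> X \<and> y \<in> Y} \<subseteq> X + uminus ` Y"
    by (auto simp: set_plus_def)
  then show ?thesis using bd_subset[OF bd_plus[OF assms(1) bd_uminus[OF assms(2)]]] by blast
qed

lemma bd_power: "bd X \<Longrightarrow> bd (X ^ k)"
  by (induction k) (auto intro: bd_times bd_singleton)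

lemma bd_sum: "finite J \<Longrightarrow> (\<And>j. j \<in> J \<Longrightarrow> bd (X j)) \<Longrightarrow> bd (\<Sum>j\<in>J. X j)"
  by (induction J rule: finite_induct) (auto intro: bd_plus bd_singleton)

end

lemma set_power_intro: "x \<in> X \<Longrightarrow> x ^ k \<in> (X :: 'a::comm_monoid_mult set) ^ k"
  by (induction k) (auto intro: set_times_intro)

lemma set_sum_mem:
  fixes f :: "'i \<Rightarrow> 'a::comm_monoid_add"
  shows "finite J \<Longrightarrow> (\<And>j. j \<in> J \<Longrightarrow> f j \<in> X j) \<Longrightarrow> (\<Sum>j\<in>J. f j) \<in> (\<Sum>j\<in>J. X j)"
  by (induction J rule: finite_induct) (auto intro: set_plus_intro)

context lb_ball
begin

text \<open>Uniformity is the point: \<open>W\<close> depends only on the number of terms and on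
  \<open>G\<close>, so weights can be fixed before the coefficients are known.\<close>

lemma nb_sum_mult:
  assumes "nb U" "bd G"
  shows "\<exists>W. nb W \<and> (\<forall>b g. (\<forall>j<(k::nat). b j \<in> W \<and> g j \<in> G) \<longrightarrow> (\<Sum>j<k. b j * g j) \<in> U)"
  using assms(1)
proof (induction k arbitrary: U)
  case 0
  then show ?case using nb_zero by auto
next
  case (Suc k)
  obtain V where V: "nb V" "\<forall>v\<in>V. \<forall>w\<in>V. v + w \<in> U" using nb_plus[OF Suc.prems] by blast
  obtain W where W: "nb W" "\<And>b g. (\<forall>j<k. b j \<in> W \<and> g j \<in> G) \<Longrightarrow> (\<Sum>j<k. b j * g j) \<in> V"
    using Suc.IH[OF V(1)] by blast
  obtain W' where W': "nb W'" "\<forall>v\<in>W'. \<forall>x\<in>G. v * x \<in> V" using nb_mult[OF V(1) assms(2)] by blast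
  have "(\<Sum>j<Suc k. b j * g j) \<in> U" if "\<forall>j<Suc k. b j \<in> W \<inter> W' \<and> g j \<in> G" for b g
  proof -
    have "(\<Sum>j<k. b j * g j) \<in> V" using W(2)[of b g] that by auto
    moreover have "b k * g k \<in> V" using W' that by auto
    ultimately show ?thesis using V by auto
  qed
  then show ?case using nb_Int[OF W(1) W'(1)] by blast
qed

lemma nb_not_one: "\<exists>U. nb U \<and> 1 \<notin> U"
proof -
  obtain c where c: "c \<noteq> 0" "c * 1 \<notin> A" using sep_ball[of 1] by auto
  have "nb {x. c * x \<in> A}" using nb_scale[OF nb_A c(1)] .
  then show ?thesis using c by blast
qed

text \<open>Separation enters here: some neighbourhood omits 1, so small elements have no inverse in
  a given bounded set. The contradictions below arise in this way.\<close>

lemma nb_mult_neq_one: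
  assumes "bd X" shows "\<exists>U. nb U \<and> (\<forall>u\<in>U. \<forall>x\<in>X. u * x \<noteq> 1)"
proof -
  obtain U where U: "nb U" "1 \<notin> U" using nb_not_one by blast
  show ?thesis using nb_mult[OF U(1) assms] U(2) by metis
qed

end

section \<open>Powers of elements without bounded inverse\<close>

locale local_weight = lb_ball A for A :: "'k::field set" +
  fixes S :: "'k::field set" and n :: nat
  assumes bd_S: "bd S"
    and W_S: "W_set n S"
    and loc: "bd B \<Longrightarrow> \<exists>C. bd C \<and> (\<forall>x\<in>B. \<exists>c\<in>C. x * c = 1 \<or> (1 - x) * c = 1)"
begin

text \<open>For a single element the sum is empty, so a \<open>W_set\<close> of index 0 would make
  every element zero.\<close>

lemma n_pos: "n > 0"
proof (rule ccontr)
  assume "\<not> n > 0"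
  then have "W_set 0 S" using W_S by simp
  then show False
    unfolding W_set_def by (auto dest!: spec[of _ "\<lambda>_. 1"])
qed

text \<open>This is \<open>loc\<close> at \<open>x * y / a\<close>, made homogeneous: an inverse of
  \<open>x * y / a\<close> yields one of \<open>x\<close>, and an inverse of
  \<open>1 - x * y / a\<close> yields one of \<open>a - x * y\<close>. It will split a polynomial in
  \<open>x\<close> into its lowest term \<open>a\<close> and the rest.\<close>

lemma unit_or_unit:
  assumes "bd B" "bd X" "a \<noteq> 0"
  shows "\<exists>C. bd C \<and> (\<forall>x\<in>B. \<forall>y\<in>X. \<exists>c\<in>C. x * c = 1 \<or> (a - x * y) * c = 1)"
proof -
  have "bd (B * X * {inverse a})" by (intro bd_times bd_singleton assms)
  from loc[OF this] obtain C where C: "bd C"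
    "\<forall>x\<in>B * X * {inverse a}. \<exists>c\<in>C. x * c = 1 \<or> (1 - x) * c = 1" by blast
  let ?C = "C * {inverse a} \<union> X * {inverse a} * C"
  have "\<exists>c\<in>?C. x * c = 1 \<or> (a - x * y) * c = 1" if "x \<in> B" "y \<in> X" for x y
  proof -
    have "x * y * inverse a \<in> B * X * {inverse a}" using that by (blast intro: set_times_intro)
    then obtain c where c: "c \<in> C"
      "x * y * inverse a * c = 1 \<or> (1 - x * y * inverse a) * c = 1" using C(2) by blast
    from c(2) show ?thesis
    proof
      assume "x * y * inverse a * c = 1"
      then have "x * (y * inverse a * c) = 1" by (simp add: mult.assoc)
      moreover have "y * inverse a * c \<in> ?C" using that c by (blast intro: set_times_intro)
      ultimately show ?thesis by blast
    next
      assume "(1 - x * y * inverse a) * c = 1"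
      then have "(a - x * y) * (c * inverse a) = 1" using assms(3) by (simp add: field_simps)
      moreover have "c * inverse a \<in> ?C" using that c by (blast intro: set_times_intro)
      ultimately show ?thesis by blast
    qed
  qed
  moreover have "bd ?C" using C(1) assms by (intro bd_Un bd_times bd_singleton)
  ultimately show ?thesis by blast
qed

text \<open>The \<open>W\<^sub>n\<close> property is applied to \<open>a\<^sub>0, a\<^sub>1 x, \<dots>, a\<^sub>n x\<^sup>n\<close>, with the weights
  chosen downwards from \<open>a\<^sub>n\<close>, each one small in terms of the later ones.\<close>

lemma nonunit_power:
  assumes B: "bd B" and U: "nb U"
  shows "\<exists>C. bd C \<and> (\<forall>x\<in>B. x ^ n \<in> U \<or> (\<exists>c\<in>C. x * c = 1))"
proof -
  define rel where "rel b x i \<longleftrightarrow> (\<exists>s. (\<forall>j\<in>{..n} - {i}. s j \<in> S) \<and>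
      b i * x ^ i = (\<Sum>j\<in>{..n} - {i}. s j * (b j * x ^ j)))" for b :: "nat \<Rightarrow> 'k" and x i
  \<comment> \<open>\<open>Q i\<close> fixes the weights from index \<open>i\<close> on and leaves
    the lower ones free in a neighbourhood; it settles the relations that express a term of index at
    least \<open>i\<close>. For \<open>Suc n\<close> there are none, and for 0 no free weight
    remains.\<close>
  define Q where "Q i \<longleftrightarrow> (\<exists>a C W. bd C \<and> nb W \<and> (\<forall>b x l. (\<forall>j\<ge>i. b j = a j) \<longrightarrow>
      (\<forall>j<i. b j \<in> W) \<longrightarrow> x \<in> B \<longrightarrow> i \<le> l \<longrightarrow> l \<le> n \<longrightarrow> rel b x l \<longrightarrow>
      x ^ n \<in> U \<or> (\<exists>c\<in>C. x * c = 1)))" for i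
  have "Q 0"
  proof (rule inc_induct[of 0 "Suc n" Q])
    show "Q (Suc n)" unfolding Q_def using bd_singleton nb_A by fastforce
  next
    fix i assume i: "i < Suc n" and "Q (Suc i)"
    then obtain a C W where C: "bd C" and W: "nb W"
      and IH: "\<And>b x l. \<lbrakk>\<forall>j\<ge>Suc i. b j = a j; \<forall>j<Suc i. b j \<in> W; x \<in> B; Suc i \<le> l; l \<le> n; rel b x l\<rbrakk>
        \<Longrightarrow> x ^ n \<in> U \<or> (\<exists>c\<in>C. x * c = 1)"
      unfolding Q_def by metis
    obtain w where w: "w \<in> W" "w \<noteq> 0" using nb_nonzero[OF W] by blast
    \<comment> \<open>In the relation for the term \<open>i\<close>, the terms above
      \<open>i\<close> have the common factor \<open>x ^ Suc i\<close>; \<open>X\<close> is a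
      bounded set that contains the cofactor \<open>y\<close>. What remains is
      \<open>x ^ i * (w - x * y)\<close>, equal to the sum of the lower terms.\<close>
    define X where "X = (\<Sum>j\<in>{i<..n}. S * ({a j} * B ^ (j - i - 1)))"
    have "bd X" unfolding X_def using B bd_S
      by (intro bd_sum bd_times bd_singleton bd_power) auto
    then obtain C1 where C1: "bd C1"
      "\<And>x y. x \<in> B \<Longrightarrow> y \<in> X \<Longrightarrow> \<exists>c\<in>C1. x * c = 1 \<or> (w - x * y) * c = 1"
      using unit_or_unit[OF B _ w(2)] by metis
    \<comment> \<open>If \<open>c\<close> is an inverse of \<open>w - x * y\<close>, then
      \<open>x ^ n\<close> is a combination of the lower weights with coefficients in
      \<open>G\<close>, and is small once these weights are.\<close>
    define G where "G = (\<Union>j\<in>{..<i}. B ^ (n - i) * C1 * (S * B ^ j))"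
    have "bd G" unfolding G_def using B bd_S C1(1)
      by (intro bd_UN bd_times bd_power) auto
    then obtain W' where W': "nb W'"
      "\<And>b g. (\<forall>j<i. b j \<in> W' \<and> g j \<in> G) \<Longrightarrow> (\<Sum>j<i. b j * g j) \<in> U"
      using nb_sum_mult[OF U] by metis
    have "x ^ n \<in> U \<or> (\<exists>c\<in>C \<union> C1. x * c = 1)"
      if b: "\<forall>j\<ge>i. b j = (a(i := w)) j" and bW: "\<forall>j<i. b j \<in> W \<inter> W'" and x: "x \<in> B"
        and l: "i \<le> l" "l \<le> n" and r: "rel b x l" for b x l
    proof (cases "l = i")
      case False
      then have "Suc i \<le> l" using l by simp
      moreover have "\<forall>j\<ge>Suc i. b j = a j" using b by simp
      moreover have "\<forall>j<Suc i. b j \<in> W" using b bW w by (auto simp: less_Suc_eq)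
      ultimately show ?thesis using IH[of b x l] x l r by blast
    next
      case True
      obtain s where s: "\<And>j. j \<in> {..n} - {i} \<Longrightarrow> s j \<in> S"
        "b i * x ^ i = (\<Sum>j\<in>{..n} - {i}. s j * (b j * x ^ j))"
        using r unfolding rel_def True by blast
      define y where "y = (\<Sum>j\<in>{i<..n}. s j * (a j * x ^ (j - i - 1)))"
      have yX: "y \<in> X" unfolding y_def X_def
        by (rule set_sum_mem) (auto intro!: set_times_intro set_power_intro s x)
      have J: "{..n} - {i} = {..<i} \<union> {i<..n}" "{..<i} \<inter> {i<..n} = {}" using i by auto
      have "b i * x ^ i = (\<Sum>j<i. s j * (b j * x ^ j)) + (\<Sum>j\<in>{i<..n}. s j * (b j * x ^ j))"
        unfolding s(2) J(1) by (rule sum.union_disjoint) (simp_all add: J(2))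
      also have "(\<Sum>j\<in>{i<..n}. s j * (b j * x ^ j)) = x ^ i * (x * y)"
        unfolding y_def sum_distrib_left
      proof (rule sum.cong)
        fix j assume j: "j \<in> {i<..n}"
        then have "x ^ j = x ^ i * (x * x ^ (j - i - 1))"
          by (simp flip: power_Suc power_add add: Suc_diff_Suc)
        then show "s j * (b j * x ^ j) = x ^ i * (x * (s j * (a j * x ^ (j - i - 1))))"
          using b j by (simp add: algebra_simps)
      qed simp
      finally have eq: "x ^ i * (w - x * y) = (\<Sum>j<i. s j * (b j * x ^ j))"
        using b by (simp add: algebra_simps)
      obtain c where c: "c \<in> C1" "x * c = 1 \<or> (w - x * y) * c = 1" using C1(2)[OF x yX] by blast
      from c(2) show ?thesis
      proof
        assume "x * c = 1" then show ?thesis using c by blast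
      next
        assume 1: "(w - x * y) * c = 1"
        have "x ^ n = x ^ (n - i) * x ^ i" using i by (simp flip: power_add)
        also have "\<dots> = x ^ (n - i) * x ^ i * ((w - x * y) * c)" unfolding 1 by simp
        also have "\<dots> = x ^ (n - i) * c * (x ^ i * (w - x * y))" by (simp only: mult_ac)
        also have "\<dots> = (\<Sum>j<i. b j * (x ^ (n - i) * c * (s j * x ^ j)))"
          unfolding eq sum_distrib_left by (simp add: algebra_simps)
        also have "\<dots> \<in> U"
        proof (rule W'(2), intro allI impI conjI)
          fix j assume j: "j < i"
          then show "b j \<in> W'" using bW by blast
          have "x ^ (n - i) * c * (s j * x ^ j) \<in> B ^ (n - i) * C1 * (S * B ^ j)"
            using j i by (intro set_times_intro set_power_intro x c s) auto
          then show "x ^ (n - i) * c * (s j * x ^ j) \<in> G" unfolding G_def using j by blast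
        qed
        finally show ?thesis by blast
      qed
    qed
    then show "Q i" unfolding Q_def
      using bd_Un[OF C C1(1)] nb_Int[OF W W'(1)] by blast
  qed simp
  then obtain a C W where C: "bd C"
    and Q0: "\<forall>b x l. (\<forall>j\<ge>0. b j = a j) \<longrightarrow> (\<forall>j<0. b j \<in> W) \<longrightarrow> x \<in> B \<longrightarrow> 0 \<le> l \<longrightarrow> l \<le> n \<longrightarrow>
      rel b x l \<longrightarrow> x ^ n \<in> U \<or> (\<exists>c\<in>C. x * c = 1)"
    unfolding Q_def by (elim exE conjE)
  have *: "x ^ n \<in> U \<or> (\<exists>c\<in>C. x * c = 1)" if "x \<in> B" "l \<le> n" "rel a x l" for x l
    using spec[OF Q0, of a] that by simp
  have "\<exists>l\<le>n. rel a x l" for x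
    using W_S[unfolded W_set_def, rule_format, of "\<lambda>j. a j * x ^ j"] unfolding rel_def by auto
  then show ?thesis using C * by blast
qed

text \<open>Non-units of a local ring are closed under sums. If \<open>(z + w) ^ n\<close> is not
  small, then \<open>z + w\<close> has a bounded inverse \<open>c\<close>, and
  \<open>z * c + w * c = 1\<close>. By locality \<open>z\<close> or \<open>w\<close> has a bounded
  inverse, so one of their powers is not small either.\<close>

lemma small_plus:
  assumes B: "bd B" and U: "nb U"
  shows "\<exists>V. nb V \<and> (\<forall>z\<in>B. \<forall>w\<in>B. z ^ n \<in> V \<longrightarrow> w ^ n \<in> V \<longrightarrow> (z + w) ^ n \<in> U)"
proof -
  obtain C where C: "bd C" "\<And>x. x \<in> B + B \<Longrightarrow> x ^ n \<in> U \<or> (\<exists>c\<in>C. x * c = 1)"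
    using nonunit_power[OF bd_plus[OF B B] U] by blast
  obtain C' where C': "bd C'" "\<And>x. x \<in> B * C \<Longrightarrow> \<exists>c\<in>C'. x * c = 1 \<or> (1 - x) * c = 1"
    using loc[OF bd_times[OF B C(1)]] by blast
  obtain V where V: "nb V" "\<And>v x. v \<in> V \<Longrightarrow> x \<in> (C * C') ^ n \<Longrightarrow> v * x \<noteq> 1"
    using nb_mult_neq_one[OF bd_power[OF bd_times[OF C(1) C'(1)]]] by metis
  have "(z + w) ^ n \<in> U" if z: "z \<in> B" "z ^ n \<in> V" and w: "w \<in> B" "w ^ n \<in> V" for z w
  proof (rule ccontr)
    assume "(z + w) ^ n \<notin> U"
    then obtain c where c: "c \<in> C" "(z + w) * c = 1"
      using C(2)[of "z + w"] z w by (blast intro: set_plus_intro)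
    have "z * c \<in> B * C" using z c by (blast intro: set_times_intro)
    then obtain c' where c': "c' \<in> C'" "(z * c) * c' = 1 \<or> (1 - z * c) * c' = 1" using C'(2) by blast
    have "1 - z * c = w * c" using c by (simp add: algebra_simps)
    then have "z * (c * c') = 1 \<or> w * (c * c') = 1" using c' by (simp add: mult.assoc)
    then have "z ^ n * (c * c') ^ n = 1 \<or> w ^ n * (c * c') ^ n = 1"
      by (metis power_mult_distrib power_one)
    moreover have "(c * c') ^ n \<in> (C * C') ^ n"
      using c c' by (blast intro: set_power_intro set_times_intro)
    ultimately show False using V(2) z w by blast
  qed
  then show ?thesis using V(1) by blast
qed

section \<open>Elements approximable by a bounded set up to such errors\<close>

definition thick :: "'k set \<Rightarrow> 'k set" where
  "thick B = {e. \<forall>U. nb U \<longrightarrow> (\<exists>s\<in>B. (e - s) ^ n \<in> U)}"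

lemma thickI: "(\<And>U. nb U \<Longrightarrow> \<exists>s\<in>B. (e - s) ^ n \<in> U) \<Longrightarrow> e \<in> thick B"
  unfolding thick_def by blast

lemma thickD: "e \<in> thick B \<Longrightarrow> nb U \<Longrightarrow> \<exists>s\<in>B. (e - s) ^ n \<in> U"
  unfolding thick_def by blast

lemma thick_mono: "B \<subseteq> C \<Longrightarrow> thick B \<subseteq> thick C"
  unfolding thick_def by blast

lemma subset_thick: "B \<subseteq> thick B"
proof
  fix e assume "e \<in> B"
  then show "e \<in> thick B"
    by (intro thickI bexI[of _ e]) (use nb_zero n_pos in \<open>auto simp: zero_power\<close>)
qed

text \<open>The errors add up, and \<open>small_plus\<close> controls their sum. It is uniform only
  on bounded sets; since \<open>e\<close> and \<open>f\<close> are fixed, the errors lie in the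
  bounded set \<open>X\<close>.\<close>

lemma thick_plus:
  assumes "bd B" "bd C" "e \<in> thick B" "f \<in> thick C"
  shows "e + f \<in> thick (B + C)"
proof (rule thickI)
  fix U assume U: "nb U"
  define X where "X = {x - y |x y. x \<in> {e} \<and> y \<in> B} \<union> {x - y |x y. x \<in> {f} \<and> y \<in> C}"
  have "bd X" unfolding X_def by (intro bd_Un bd_diff bd_singleton assms)
  then obtain V where V: "nb V" "\<And>z w. \<lbrakk>z \<in> X; w \<in> X; z ^ n \<in> V; w ^ n \<in> V\<rbrakk> \<Longrightarrow> (z + w) ^ n \<in> U"
    using small_plus[OF _ U] by metis
  obtain s where s: "s \<in> B" "(e - s) ^ n \<in> V" using thickD[OF assms(3) V(1)] by blast
  obtain t where t: "t \<in> C" "(f - t) ^ n \<in> V" using thickD[OF assms(4) V(1)] by blast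
  have "((e - s) + (f - t)) ^ n \<in> U" using s t by (intro V(2)) (auto simp: X_def)
  then have "(e + f - (s + t)) ^ n \<in> U" by (simp add: algebra_simps)
  then show "\<exists>s\<in>B + C. (e + f - s) ^ n \<in> U" using s t by (blast intro: set_plus_intro)
qed

text \<open>The error splits as \<open>e * f - s * t = (e - s) * f + s * (f - t)\<close>. Its parts
  carry the bounded factors \<open>f\<close> and \<open>s\<close>, which \<open>W\<close>
  compensates.\<close>

lemma thick_times:
  assumes "bd B" "bd C" "e \<in> thick B" "f \<in> thick C"
  shows "e * f \<in> thick (B * C)"
proof (rule thickI)
  fix U assume U: "nb U"
  define X where "X = {x - y |x y. x \<in> {e} \<and> y \<in> B} * {f} \<union> B * {x - y |x y. x \<in> {f} \<and> y \<in> C}"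
  have "bd X" unfolding X_def by (intro bd_Un bd_diff bd_times bd_singleton assms)
  then obtain V where V: "nb V" "\<And>z w. \<lbrakk>z \<in> X; w \<in> X; z ^ n \<in> V; w ^ n \<in> V\<rbrakk> \<Longrightarrow> (z + w) ^ n \<in> U"
    using small_plus[OF _ U] by metis
  have "bd (insert f B)" by (intro bd_insert assms)
  then obtain W where W: "nb W" "\<And>w y. w \<in> W \<Longrightarrow> y \<in> insert f B ^ n \<Longrightarrow> w * y \<in> V"
    using nb_mult[OF V(1) bd_power] by metis
  obtain s where s: "s \<in> B" "(e - s) ^ n \<in> W" using thickD[OF assms(3) W(1)] by blast
  obtain t where t: "t \<in> C" "(f - t) ^ n \<in> W" using thickD[OF assms(4) W(1)] by blast
  have "((e - s) * f) ^ n \<in> V" "(s * (f - t)) ^ n \<in> V"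
    using W(2)[OF s(2), of "f ^ n"] W(2)[OF t(2), of "s ^ n"] s
    by (auto simp: power_mult_distrib mult.commute intro: set_power_intro)
  moreover have "(e - s) * f \<in> X" "s * (f - t) \<in> X"
    using s t unfolding X_def by (blast intro: set_times_intro)+
  ultimately have "((e - s) * f + s * (f - t)) ^ n \<in> U" by (intro V(2))
  then have "(e * f - s * t) ^ n \<in> U" by (simp add: algebra_simps)
  then show "\<exists>s\<in>B * C. (e * f - s) ^ n \<in> U" using s t by (blast intro: set_times_intro)
qed

lemma thick_scale:
  assumes "e \<in> thick B"
  shows "c * e \<in> thick ((*) c ` B)"
proof (rule thickI)
  fix U assume U: "nb U"
  obtain V where V: "nb V" "\<forall>v\<in>V. v * c ^ n \<in> U" using nb_mult[OF U bd_singleton] by blast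
  obtain s where s: "s \<in> B" "(e - s) ^ n \<in> V" using thickD[OF assms V(1)] by blast
  have "(c * e - c * s) ^ n = (e - s) ^ n * c ^ n"
    by (simp add: right_diff_distrib[symmetric] power_mult_distrib)
  then have "(c * e - c * s) ^ n \<in> U" using V s by simp
  then show "\<exists>s\<in>(*) c ` B. (c * e - s) ^ n \<in> U" using s by blast
qed

lemma zero_in_thick: "0 \<in> B \<Longrightarrow> 0 \<in> thick B"
  using subset_thick by blast

text \<open>This is \<open>W_set\<close> with equality weakened to a small power of the difference.
  The exponent remains the fixed \<open>n\<close> for every \<open>w\<close>, and the index
  \<open>i\<close> is chosen before the neighbourhood, so that one case is valid for all
  \<open>U\<close>.\<close>

definition weight_bound :: "nat \<Rightarrow> 'k set \<Rightarrow> bool" where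
  "weight_bound w B \<longleftrightarrow> (\<forall>y. \<exists>i\<le>w. \<forall>U. nb U \<longrightarrow>
     (\<exists>s. (\<forall>j\<in>{..w} - {i}. s j \<in> B) \<and> (y i - (\<Sum>j\<in>{..w} - {i}. s j * y j)) ^ n \<in> U))"

lemma weight_bound_n: "weight_bound n S"
  unfolding weight_bound_def
proof
  fix y :: "nat \<Rightarrow> 'k"
  obtain i s where i: "i \<le> n" and s: "\<forall>j\<in>{..n} - {i}. s j \<in> S" "y i = (\<Sum>j\<in>{..n} - {i}. s j * y j)"
    using W_S unfolding W_set_def by blast
  have "(y i - (\<Sum>j\<in>{..n} - {i}. s j * y j)) ^ n \<in> U" if "nb U" for U
    using s(2) nb_zero[OF that] n_pos by (simp add: zero_power)
  then show "\<exists>i\<le>n. \<forall>U. nb U \<longrightarrow>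
     (\<exists>s. (\<forall>j\<in>{..n} - {i}. s j \<in> S) \<and> (y i - (\<Sum>j\<in>{..n} - {i}. s j * y j)) ^ n \<in> U)"
    using i s(1) by blast
qed

lemma not_weight_bound_0: "\<not> weight_bound 0 B"
proof
  assume "weight_bound 0 B"
  then have "\<forall>U. nb U \<longrightarrow> (1::'k) ^ n \<in> U" unfolding weight_bound_def
    by (auto dest!: spec[of _ "\<lambda>_. 1"])
  then show False using nb_not_one by auto
qed

text \<open>With \<open>w\<close> the least weight bound and \<open>y\<^sub>0, \<dots>, y\<^sub>v\<close> (\<open>v = w - 1\<close>) a witness that \<open>v\<close> is none,
  the bound \<open>w\<close> is applied to \<open>y\<^sub>0, \<dots>, y\<^sub>v, e y\<^sub>0\<close>.\<close>

lemma thick_dichotomy: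
  "\<exists>B. bd B \<and> (\<forall>e. e \<in> thick B \<or> inverse e \<in> thick B)"
proof -
  define w where "w = (LEAST w. \<exists>B. bd B \<and> weight_bound w B)"
  have "\<exists>B. bd B \<and> weight_bound w B"
    unfolding w_def by (rule LeastI[of _ n]) (use bd_S weight_bound_n in blast)
  then obtain B where B: "bd B" "weight_bound w B" by blast
  obtain v where wv: "w = Suc v" using B not_weight_bound_0 by (cases w) auto
  define B' where "B' = insert 0 B"
  have B': "bd B'" unfolding B'_def by (rule bd_insert[OF B(1)])
  have "\<not> (\<exists>B. bd B \<and> weight_bound v B)"
    by (rule not_less_Least) (simp flip: w_def add: wv)
  then have "\<not> weight_bound v B'" using B' by blast
  then obtain y where y: "\<not> (\<exists>i\<le>v. \<forall>U. nb U \<longrightarrow>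
     (\<exists>s. (\<forall>j\<in>{..v} - {i}. s j \<in> B') \<and> (y i - (\<Sum>j\<in>{..v} - {i}. s j * y j)) ^ n \<in> U))"
    unfolding weight_bound_def not_all by (elim exE)
  define adm where "adm i s \<longleftrightarrow> (\<forall>j\<in>{..v} - {i}. s j \<in> B')" for i s
  define err where "err i s = y i - (\<Sum>j\<in>{..v} - {i}. s j * y j)" for i s
  have "\<not> (\<exists>i\<le>v. \<forall>U. nb U \<longrightarrow> (\<exists>s. adm i s \<and> err i s ^ n \<in> U))"
    unfolding adm_def err_def by (rule y)
  then have "\<forall>i. \<exists>U. i \<le> v \<longrightarrow> nb U \<and> (\<forall>s. adm i s \<longrightarrow> err i s ^ n \<notin> U)" by blast
  then obtain U where "\<forall>i. i \<le> v \<longrightarrow> nb (U i) \<and> (\<forall>s. adm i s \<longrightarrow> err i s ^ n \<notin> U i)"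
    by (rule choice[THEN exE])
  then have U: "\<And>i. i \<le> v \<Longrightarrow> nb (U i)" "\<And>i s. i \<le> v \<Longrightarrow> adm i s \<Longrightarrow> err i s ^ n \<notin> U i"
    by blast+
  have y0: "y 0 \<noteq> 0"
    using U(2)[of 0 "\<lambda>_. 0"] nb_zero[OF U(1), of 0] n_pos by (auto simp: B'_def adm_def err_def zero_power)
  have "nb (\<Inter>i\<in>{..v}. U i)" using U(1) by (intro nb_INT) auto
  \<comment> \<open>\<open>X i\<close> contains the residues of \<open>y i\<close> modulo
    combinations of the other \<open>y j\<close>. By the choice of \<open>y\<close> their powers
    avoid \<open>U i\<close>, so \<open>nonunit_power\<close> gives them inverses in one bounded set
    \<open>C\<close>.\<close>
  define X where "X i = {x - z | x z. x \<in> {y i} \<and> z \<in> (\<Sum>j\<in>{..v} - {i}. B' * {y j})}" for i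
  have "bd (\<Union>i\<in>{..v}. X i)" unfolding X_def
    by (intro bd_UN bd_diff bd_sum bd_times bd_singleton B') auto
  then obtain C where C: "bd C" "\<And>x. x \<in> (\<Union>i\<in>{..v}. X i) \<Longrightarrow>
      x ^ n \<in> (\<Inter>i\<in>{..v}. U i) \<or> (\<exists>c\<in>C. x * c = 1)"
    using nonunit_power \<open>nb (\<Inter>i\<in>{..v}. U i)\<close> by metis
  \<comment> \<open>The first part of the union approximates \<open>e\<close> (the new element
    depends on the old ones), the second approximates \<open>1/e\<close> (an old element depends on
    the new one). Neither mentions \<open>e\<close>.\<close>
  define B1 where "B1 = insert 0 ((\<Sum>j\<in>{..v}. B * {y j}) * {inverse (y 0)} \<union> B * {y 0} * C)"
  have "bd B1" unfolding B1_def
    by (intro bd_insert bd_Un bd_times bd_sum bd_singleton B C(1)) auto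
  moreover have "e \<in> thick B1 \<or> inverse e \<in> thick B1" for e
  proof (cases "e = 0")
    case True
    then show ?thesis using zero_in_thick[of B1] by (simp add: B1_def)
  next
    case False
    define y' where "y' = y(w := e * y 0)"
    obtain i where i: "i \<le> w" and *: "\<And>U. nb U \<Longrightarrow>
        \<exists>s. (\<forall>j\<in>{..w} - {i}. s j \<in> B) \<and> (y' i - (\<Sum>j\<in>{..w} - {i}. s j * y' j)) ^ n \<in> U"
      using B(2) unfolding weight_bound_def by metis
    show ?thesis
    proof (cases "i = w")
      case True
      have "e \<in> thick B1"
      proof (rule thickI)
        fix U assume "nb U"
        then obtain V where V: "nb V" "\<forall>v\<in>V. v * inverse (y 0) ^ n \<in> U"
          using nb_mult[OF _ bd_singleton] by blast
        obtain s where s: "\<forall>j\<in>{..w} - {w}. s j \<in> B"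
          "(y' w - (\<Sum>j\<in>{..w} - {w}. s j * y' j)) ^ n \<in> V" using *[OF V(1)] True by blast
        have w: "{..w} - {w} = {..v}" using wv by auto
        define t where "t = (\<Sum>j\<in>{..v}. s j * y j)"
        have "(\<Sum>j\<in>{..w} - {w}. s j * y' j) = t" unfolding w t_def
          by (rule sum.cong) (auto simp: y'_def wv)
        then have "(e * y 0 - t) ^ n \<in> V" using s(2) by (simp add: y'_def)
        then have "(e * y 0 - t) ^ n * inverse (y 0) ^ n \<in> U" using V by blast
        then have "(e - t * inverse (y 0)) ^ n \<in> U"
          using y0 by (simp flip: power_mult_distrib add: algebra_simps)
        moreover have "t \<in> (\<Sum>j\<in>{..v}. B * {y j})" unfolding t_def
          by (rule set_sum_mem) (use s w in \<open>auto intro: set_times_intro\<close>)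
        then have "t * inverse (y 0) \<in> B1" unfolding B1_def by (blast intro: set_times_intro)
        ultimately show "\<exists>s\<in>B1. (e - s) ^ n \<in> U" by blast
      qed
      then show ?thesis ..
    next
      case False
      then have iv: "i \<le> v" using i wv by simp
      have "inverse e \<in> thick B1"
      proof (rule thickI)
        fix U' assume "nb U'"
        \<comment> \<open>The size of \<open>1/e\<close> affects only the neighbourhood
          \<open>V\<close>, never the set \<open>B1\<close>.\<close>
        then obtain V where V: "nb V" "\<And>v x. v \<in> V \<Longrightarrow> x \<in> (C * {inverse e}) ^ n \<Longrightarrow> v * x \<in> U'"
          using nb_mult[OF _ bd_power[OF bd_times[OF C(1) bd_singleton]]] by metis
        obtain s where s: "\<forall>j\<in>{..w} - {i}. s j \<in> B"
          "(y' i - (\<Sum>j\<in>{..w} - {i}. s j * y' j)) ^ n \<in> V" using *[OF V(1)] by blast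
        have w: "{..w} - {i} = insert w ({..v} - {i})" using wv iv by auto
        define u where "u = err i s"
        have "(\<Sum>j\<in>{..w} - {i}. s j * y' j) = s w * y' w + (\<Sum>j\<in>{..v} - {i}. s j * y' j)"
          unfolding w by (rule sum.insert) (auto simp: wv)
        also have "(\<Sum>j\<in>{..v} - {i}. s j * y' j) = (\<Sum>j\<in>{..v} - {i}. s j * y j)"
          by (rule sum.cong) (auto simp: y'_def wv)
        finally have z: "(u - s w * y 0 * e) ^ n \<in> V"
          using s(2) iv by (simp add: y'_def wv u_def err_def algebra_simps)
        have sB': "\<forall>j\<in>{..v} - {i}. s j \<in> B'" using s(1) unfolding w B'_def by blast
        have "(\<Sum>j\<in>{..v} - {i}. s j * y j) \<in> (\<Sum>j\<in>{..v} - {i}. B' * {y j})"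
          by (rule set_sum_mem) (use sB' in \<open>auto intro: set_times_intro\<close>)
        then have "u \<in> X i" unfolding X_def u_def err_def by blast
        moreover have "u ^ n \<notin> U i" unfolding u_def using U(2)[OF iv] sB' by (simp add: adm_def)
        ultimately obtain c where c: "c \<in> C" "u * c = 1" using C(2)[of u] iv by blast
        \<comment> \<open>Division of the relation \<open>u\<close> near
          \<open>s w * y 0 * e\<close> by \<open>u * e\<close>, where \<open>c\<close> is the
          inverse of the residue \<open>u\<close>.\<close>
        have "inverse e - s w * y 0 * c = inverse e * (u * c) - s w * y 0 * c"
          using c(2) by simp
        also have "\<dots> = (u - s w * y 0 * e) * (c * inverse e)"
          using False \<open>e \<noteq> 0\<close> by (simp add: field_simps)
        finally have "(inverse e - s w * y 0 * c) ^ n = (u - s w * y 0 * e) ^ n * (c * inverse e) ^ n"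
          by (simp add: power_mult_distrib)
        moreover have "(c * inverse e) ^ n \<in> (C * {inverse e}) ^ n"
          using c by (blast intro: set_power_intro set_times_intro)
        ultimately have "(inverse e - s w * y 0 * c) ^ n \<in> U'" using V(2)[OF z] by simp
        moreover have "s w * y 0 * c \<in> B1" unfolding B1_def
          using s(1) w c(1) by (blast intro: set_times_intro)
        ultimately show "\<exists>s\<in>B1. (inverse e - s) ^ n \<in> U'" by blast
      qed
      then show ?thesis ..
    qed
  qed
  ultimately show ?thesis by blast
qed

text \<open>For \<open>f\<close> small enough the element \<open>1/f\<close> is too large to be
  approximated. Every \<open>f * s\<close> with \<open>s\<close> in \<open>B\<close> is then without
  inverse in \<open>C\<close>, so locality inverts \<open>1 - f * s\<close>; hence
  \<open>1/f - s\<close> has a bounded inverse and its power is not small.\<close>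

lemma thick_proper:
  assumes "bd B" shows "thick B \<noteq> UNIV"
proof
  assume *: "thick B = UNIV"
  obtain C where C: "bd C" "\<And>x. x \<in> A \<Longrightarrow> \<exists>c\<in>C. x * c = 1 \<or> (1 - x) * c = 1"
    using loc[OF bd_A] by blast
  obtain V where V: "nb V" "\<And>v x. v \<in> V \<Longrightarrow> x \<in> C \<Longrightarrow> v * x \<noteq> 1"
    using nb_mult_neq_one[OF C(1)] by metis
  obtain f where f: "f \<noteq> 0" "\<forall>x\<in>B. f * x \<in> V \<inter> A"
    using scale_into[OF nb_Int[OF V(1) nb_A] assms] by blast
  obtain W where W: "nb W" "\<And>v x. v \<in> W \<Longrightarrow> x \<in> ({f} * C) ^ n \<Longrightarrow> v * x \<noteq> 1"
    using nb_mult_neq_one[OF bd_power[OF bd_times[OF bd_singleton C(1)]]] by metis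
  have "inverse f \<in> thick B" using * by blast
  then obtain s where s: "s \<in> B" "(inverse f - s) ^ n \<in> W" using thickD W(1) by blast
  have "f * s \<in> V" "f * s \<in> A" using f s by auto
  then obtain c where c: "c \<in> C" "(1 - f * s) * c = 1" using C(2) V(2) by blast
  have "(inverse f - s) * (f * c) = (1 - f * s) * c" using f(1) by (simp add: field_simps)
  then have "(inverse f - s) * (f * c) = 1" using c(2) by simp
  then have "(inverse f - s) ^ n * (f * c) ^ n = 1" by (metis power_mult_distrib power_one)
  moreover have "(f * c) ^ n \<in> ({f} * C) ^ n" using c by (blast intro: set_power_intro set_times_intro)
  ultimately show False using W(2) s(2) by blast
qed

end

section \<open>The topology of a bounded neighbourhood\<close>


text \<open>The formula spells out \<open>nb\<close> because it is stated for an arbitrary set;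
  under the axioms of \<open>lb_ball\<close> it does define a topology.\<close>

definition ball_topology :: "'k::field set \<Rightarrow> 'k topology" where
  "ball_topology A = topology (\<lambda>W. \<forall>x\<in>W. \<exists>c. c \<noteq> 0 \<and> (\<forall>a\<in>A. x + c * a \<in> W))"

context lb_ball
begin

lemma nb_uminus: "nb U \<Longrightarrow> nb {x. - x \<in> U}"
  using nb_scale[of U "- 1"] by simp

lemma openin_ball_topology: "openin (ball_topology A) W \<longleftrightarrow> (\<forall>x\<in>W. nb {y. x + y \<in> W})"
proof -
  have "istopology (\<lambda>W. \<forall>x\<in>W. nb {y. x + y \<in> W})"
    unfolding istopology_def
  proof (intro conjI allI impI ballI)
    fix S T x
    assume "\<forall>x\<in>S. nb {y. x + y \<in> S}" "\<forall>x\<in>T. nb {y. x + y \<in> T}" "x \<in> S \<inter> T"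
    then have "nb ({y. x + y \<in> S} \<inter> {y. x + y \<in> T})" by (intro nb_Int) auto
    then show "nb {y. x + y \<in> S \<inter> T}" by (rule nb_mono) auto
  next
    fix \<K> x assume "\<forall>K\<in>\<K>. \<forall>x\<in>K. nb {y. x + y \<in> K}" "x \<in> \<Union> \<K>"
    then obtain K where K: "K \<in> \<K>" "nb {y. x + y \<in> K}" by blast
    show "nb {y. x + y \<in> \<Union> \<K>}" by (rule nb_mono[OF K(2)]) (use K(1) in auto)
  qed
  moreover have "ball_topology A = topology (\<lambda>W. \<forall>x\<in>W. nb {y. x + y \<in> W})"
    unfolding ball_topology_def nb_def by simp
  ultimately show ?thesis by (simp add: topology_inverse')
qed

lemma topspace_ball_topology: "topspace (ball_topology A) = UNIV"
proof -
  have "openin (ball_topology A) UNIV"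
    unfolding openin_ball_topology using nb_mono[OF nb_A] by simp
  then show ?thesis by (auto dest: openin_subset)
qed

lemma nbhd_zero_ball_topology: "nbhd_zero (ball_topology A) U \<longleftrightarrow> nb U"
proof
  assume "nbhd_zero (ball_topology A) U"
  then obtain V where V: "openin (ball_topology A) V" "0 \<in> V" "V \<subseteq> U" unfolding nbhd_zero_def by blast
  then have "nb {y. 0 + y \<in> V}" unfolding openin_ball_topology by blast
  then show "nb U" by (rule nb_mono) (use V in auto)
next
  assume U: "nb U"
  \<comment> \<open>The interior of \<open>U\<close>, open by \<open>nb_plus\<close>.\<close>
  define V where "V = {x. nb {y. x + y \<in> U}}"
  have "openin (ball_topology A) V"
    unfolding openin_ball_topology
  proof
    fix x assume "x \<in> V"
    then obtain P where P: "nb P" "\<forall>v\<in>P. \<forall>w\<in>P. v + w \<in> {y. x + y \<in> U}"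
      using nb_plus unfolding V_def by blast
    have "nb {y. x + p + y \<in> U}" if "p \<in> P" for p
      by (rule nb_mono[OF P(1)]) (use P(2) that in \<open>auto simp: add.assoc\<close>)
    then show "nb {y. x + y \<in> V}" unfolding V_def by (intro nb_mono[OF P(1)]) auto
  qed
  moreover have "0 \<in> V" using U by (simp add: V_def)
  moreover have "V \<subseteq> U" unfolding V_def using nb_zero by fastforce
  ultimately show "nbhd_zero (ball_topology A) U" unfolding nbhd_zero_def by blast
qed

lemma bounded_in_ball_topology: "bounded_in (ball_topology A) B \<longleftrightarrow> bd B"
proof
  assume "bounded_in (ball_topology A) B"
  then obtain V where V: "nb V" "{v * b | v b. v \<in> V \<and> b \<in> B} \<subseteq> A"
    unfolding bounded_in_def nbhd_zero_ball_topology using nb_A by blast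
  obtain v where "v \<in> V" "v \<noteq> 0" using nb_nonzero[OF V(1)] by blast
  then show "bd B" unfolding bd_def using V(2) by blast
next
  assume B: "bd B"
  show "bounded_in (ball_topology A) B"
    unfolding bounded_in_def nbhd_zero_ball_topology
  proof (intro allI impI)
    fix U assume "nb U"
    then obtain V where "nb V" "\<forall>v\<in>V. \<forall>x\<in>B. v * x \<in> U" using nb_mult[OF _ B] by blast
    then show "\<exists>V. nb V \<and> {v * b |v b. v \<in> V \<and> b \<in> B} \<subseteq> U" by blast
  qed
qed

lemma open_translate:
  assumes "nb P" shows "\<exists>W. openin (ball_topology A) W \<and> x \<in> W \<and> (\<forall>z\<in>W. z - x \<in> P)"
proof -
  obtain V where V: "openin (ball_topology A) V" "0 \<in> V" "V \<subseteq> P"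
    using assms unfolding nbhd_zero_ball_topology[symmetric] nbhd_zero_def by blast
  have "openin (ball_topology A) {z. z - x \<in> V}"
    unfolding openin_ball_topology
  proof
    fix z assume "z \<in> {z. z - x \<in> V}"
    then have "nb {y. z - x + y \<in> V}" using V(1) unfolding openin_ball_topology by blast
    then show "nb {y. z + y \<in> {z. z - x \<in> V}}" by (rule nb_mono) (auto simp: algebra_simps)
  qed
  then show ?thesis using V by (intro exI[of _ "{z. z - x \<in> V}"]) auto
qed

text \<open>The expression is the increment \<open>(x + p) * (y + q) - x * y\<close>, as needed for
  continuity of multiplication.\<close>

lemma nb_plus_mult:
  assumes "nb U"
  shows "\<exists>P. nb P \<and> (\<forall>p\<in>P. \<forall>q\<in>P. x * q + p * y + p * q \<in> U)"
proof -
  obtain V where V: "nb V" "\<forall>v\<in>V. \<forall>w\<in>V. v + w \<in> U" using nb_plus[OF assms] by blast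
  obtain W where W: "nb W" "\<forall>v\<in>W. \<forall>w\<in>W. v + w \<in> V" using nb_plus[OF V(1)] by blast
  obtain P where P: "nb P" "\<forall>p\<in>P. \<forall>z\<in>insert x (insert y A). p * z \<in> W \<inter> V"
    using nb_mult[OF nb_Int[OF W(1) V(1)] bd_insert[OF bd_insert[OF bd_A]]] by blast
  have "x * q + p * y + p * q \<in> U" if "p \<in> P \<inter> A" "q \<in> P \<inter> A" for p q
  proof -
    have "q * x \<in> W" "p * y \<in> W" "p * q \<in> V" using P that by auto
    then show ?thesis using V W by (simp add: mult.commute)
  qed
  then show ?thesis using nb_Int[OF P(1) nb_A] by blast
qed

lemma ring_topology_ball_topology: "ring_topology (ball_topology A)"
  unfolding ring_topology_def
proof (intro conjI topspace_ball_topology)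
  let ?T = "ball_topology A"
  note [simp] = topspace_ball_topology
  \<comment> \<open>Continuity of a binary operation is reduced to its increments at a point, for
    sum and product alike.\<close>
  have prod: "continuous_map (prod_topology ?T ?T) ?T (\<lambda>(x, y). f x y)"
    if "\<And>x y U. nb U \<Longrightarrow> \<exists>P. nb P \<and> (\<forall>p\<in>P. \<forall>q\<in>P. f (x + p) (y + q) - f x y \<in> U)" for f
    unfolding continuous_map
  proof (intro conjI allI impI)
    fix U assume U: "openin ?T U"
    show "openin (prod_topology ?T ?T) {z \<in> topspace (prod_topology ?T ?T). (case z of (x, y) \<Rightarrow> f x y) \<in> U}"
      unfolding openin_prod_topology_alt
    proof (intro allI impI)
      fix x y assume "(x, y) \<in> {z \<in> topspace (prod_topology ?T ?T). (case z of (x, y) \<Rightarrow> f x y) \<in> U}"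
      then have "nb {z. f x y + z \<in> U}" using U by (simp add: openin_ball_topology)
      from that[OF this, of x y] obtain P
        where P: "nb P" "\<forall>p\<in>P. \<forall>q\<in>P. f (x + p) (y + q) \<in> U" by auto
      obtain V where V: "openin ?T V" "x \<in> V" "\<forall>z\<in>V. z - x \<in> P" using open_translate[OF P(1)] by blast
      obtain W where W: "openin ?T W" "y \<in> W" "\<forall>z\<in>W. z - y \<in> P" using open_translate[OF P(1)] by blast
      have "f v w \<in> U" if "v \<in> V" "w \<in> W" for v w
        using P(2)[rule_format, of "v - x" "w - y"] V W that by auto
      then have "V \<times> W \<subseteq> {z \<in> topspace (prod_topology ?T ?T). (case z of (x, y) \<Rightarrow> f x y) \<in> U}"
        by auto
      then show "\<exists>V W. openin ?T V \<and> openin ?T W \<and> x \<in> V \<and> y \<in> W \<and>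
          V \<times> W \<subseteq> {z \<in> topspace (prod_topology ?T ?T). (case z of (x, y) \<Rightarrow> f x y) \<in> U}"
        using V W by blast
    qed
  qed simp
  show "continuous_map (prod_topology ?T ?T) ?T (\<lambda>(x, y). x + y)"
  proof (rule prod)
    fix x y U assume "nb U"
    then show "\<exists>P. nb P \<and> (\<forall>p\<in>P. \<forall>q\<in>P. x + p + (y + q) - (x + y) \<in> U)"
      using nb_plus by (auto simp: algebra_simps)
  qed
  show "continuous_map (prod_topology ?T ?T) ?T (\<lambda>(x, y). x * y)"
  proof (rule prod)
    fix x y U assume "nb U"
    then obtain P where "nb P" "\<forall>p\<in>P. \<forall>q\<in>P. x * q + p * y + p * q \<in> U" using nb_plus_mult by blast
    moreover have "(x + p) * (y + q) - x * y = x * q + p * y + p * q" for p q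
      by (simp add: algebra_simps)
    ultimately show "\<exists>P. nb P \<and> (\<forall>p\<in>P. \<forall>q\<in>P. (x + p) * (y + q) - x * y \<in> U)" by auto
  qed
  show "continuous_map ?T ?T uminus"
    unfolding continuous_map
  proof (intro conjI allI impI)
    fix U assume U: "openin ?T U"
    show "openin ?T {x \<in> topspace ?T. - x \<in> U}"
      unfolding openin_ball_topology
    proof
      fix x assume "x \<in> {x \<in> topspace ?T. - x \<in> U}"
      then have "nb {y. - x + y \<in> U}" using U unfolding openin_ball_topology by blast
      from nb_uminus[OF this] show "nb {y. x + y \<in> {x \<in> topspace ?T. - x \<in> U}}"
        by (simp only: minus_add_distrib mem_Collect_eq topspace_ball_topology UNIV_I simp_thms)
    qed
  qed simp
qed

lemma lb_ring_topology_ball_topology: "lb_ring_topology (ball_topology A)"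
  unfolding lb_ring_topology_def
proof (intro conjI ring_topology_ball_topology)
  let ?T = "ball_topology A"
  show "Hausdorff_space ?T"
    unfolding Hausdorff_space_def
  proof (intro allI impI)
    fix x y assume "x \<in> topspace ?T \<and> y \<in> topspace ?T \<and> x \<noteq> y"
    then obtain c where c: "c \<noteq> 0" "c * (y - x) \<notin> A" using sep_ball[of "y - x"] by auto
    obtain P where P: "nb P" "\<forall>v\<in>P. \<forall>w\<in>P. v + w \<in> {z. c * z \<in> A}"
      using nb_plus[OF nb_scale[OF nb_A c(1)]] by blast
    obtain V where V: "openin ?T V" "x \<in> V" "\<forall>z\<in>V. z - x \<in> P" using open_translate[OF P(1)] by blast
    obtain W where W: "openin ?T W" "y \<in> W" "\<forall>z\<in>W. z - y \<in> {p. - p \<in> P}"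
      using open_translate[OF nb_uminus[OF P(1)]] by blast
    have "disjnt V W"
    proof (rule ccontr)
      assume "\<not> disjnt V W"
      then obtain z where z: "z \<in> V" "z \<in> W" unfolding disjnt_def by blast
      then have "z - x \<in> P" "- (z - y) \<in> P" using V W by auto
      then have "c * ((z - x) + - (z - y)) \<in> A" using P(2) by blast
      then show False using c(2) by simp
    qed
    then show "\<exists>U V. openin ?T U \<and> openin ?T V \<and> x \<in> U \<and> y \<in> V \<and> disjnt U V"
      using V W by blast
  qed
  show "?T \<noteq> discrete_topology UNIV"
  proof
    assume "?T = discrete_topology UNIV"
    then have "openin ?T {0}" by simp
    then have "nb {0}" unfolding openin_ball_topology by (auto simp: Collect_conv_if)
    then show False using nb_nonzero by blast
  qed
  show "\<exists>U. nbhd_zero ?T U \<and> bounded_in ?T U"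
    unfolding nbhd_zero_ball_topology bounded_in_ball_topology using nb_A bd_A by blast
qed

end

section \<open>From a locally bounded ring topology to a ball\<close>

lemma nbhd_zero_mono: "nbhd_zero \<tau> U \<Longrightarrow> U \<subseteq> V \<Longrightarrow> nbhd_zero \<tau> V"
  unfolding nbhd_zero_def by (meson order_trans)

lemma nbhd_zero_Int:
  assumes "nbhd_zero \<tau> U" "nbhd_zero \<tau> V" shows "nbhd_zero \<tau> (U \<inter> V)"
proof -
  obtain P where "openin \<tau> P" "0 \<in> P" "P \<subseteq> U" using assms(1) unfolding nbhd_zero_def by blast
  moreover obtain Q where "openin \<tau> Q" "0 \<in> Q" "Q \<subseteq> V" using assms(2) unfolding nbhd_zero_def by blast
  ultimately show ?thesis unfolding nbhd_zero_def by (intro exI[of _ "P \<inter> Q"]) auto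
qed

lemma bounded_in_Un:
  assumes "bounded_in \<tau> X" "bounded_in \<tau> Y" shows "bounded_in \<tau> (X \<union> Y)"
  unfolding bounded_in_def
proof (intro allI impI)
  fix U assume U: "nbhd_zero \<tau> U"
  obtain V where V: "nbhd_zero \<tau> V" "{v * b | v b. v \<in> V \<and> b \<in> X} \<subseteq> U"
    using assms(1) U unfolding bounded_in_def by blast
  obtain W where W: "nbhd_zero \<tau> W" "{v * b | v b. v \<in> W \<and> b \<in> Y} \<subseteq> U"
    using assms(2) U unfolding bounded_in_def by blast
  show "\<exists>V. nbhd_zero \<tau> V \<and> {v * b |v b. v \<in> V \<and> b \<in> X \<union> Y} \<subseteq> U"
    using V W by (intro exI[of _ "V \<inter> W"] conjI nbhd_zero_Int) blast+
qed

text \<open>Scalars suffice for two reasons: every neighbourhood of zero has a nonzero element, the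
  topology not being discrete, and boundedness of \<open>A\<close> lets such an element shrink
  \<open>A\<close> into any given neighbourhood. This is the fact \<open>into\<close> below.\<close>

lemma lb_ring_topology_imp_ball:
  assumes \<tau>: "lb_ring_topology (\<tau> :: 'k::field topology)"
  shows "\<exists>A. lb_ball A \<and> \<tau> = ball_topology A"
proof -
  have [simp]: "topspace \<tau> = UNIV"
    and plus: "continuous_map (prod_topology \<tau> \<tau>) \<tau> (\<lambda>(x, y). x + y)"
    and minus: "continuous_map \<tau> \<tau> uminus"
    and mult: "continuous_map (prod_topology \<tau> \<tau>) \<tau> (\<lambda>(x, y). x * y)"
    and haus: "Hausdorff_space \<tau>" and disc: "\<tau> \<noteq> discrete_topology UNIV"
    using \<tau> unfolding lb_ring_topology_def ring_topology_def by blast+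
  obtain U0 where U0: "nbhd_zero \<tau> U0" "bounded_in \<tau> U0" using \<tau> unfolding lb_ring_topology_def by blast
  have shift: "openin \<tau> {y. x + y \<in> W}" if "openin \<tau> W" for x W
  proof -
    have "continuous_map \<tau> \<tau> ((\<lambda>(x, y). x + y) \<circ> (\<lambda>y. (x, y)))"
      by (rule continuous_map_compose[OF _ plus]) (auto intro!: continuous_map_pairedI)
    then show ?thesis using that unfolding continuous_map by (auto simp: o_def)
  qed
  have scale: "openin \<tau> {y. y * x \<in> W}" if "openin \<tau> W" for x W
  proof -
    have "continuous_map \<tau> \<tau> ((\<lambda>(x, y). x * y) \<circ> (\<lambda>y. (y, x)))"
      by (rule continuous_map_compose[OF _ mult]) (auto intro!: continuous_map_pairedI)
    then show ?thesis using that unfolding continuous_map by (auto simp: o_def)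
  qed
  have uminus: "openin \<tau> {y. - y \<in> W}" if "openin \<tau> W" for W
    using minus that unfolding continuous_map by auto
  have nplus: "\<exists>V. nbhd_zero \<tau> V \<and> (\<forall>v\<in>V. \<forall>w\<in>V. v + w \<in> U)" if U: "nbhd_zero \<tau> U" for U
  proof -
    obtain W where W: "openin \<tau> W" "0 \<in> W" "W \<subseteq> U" using U unfolding nbhd_zero_def by blast
    define Z where "Z = {z \<in> topspace (prod_topology \<tau> \<tau>). (case z of (x, y) \<Rightarrow> x + y) \<in> W}"
    have Z: "openin (prod_topology \<tau> \<tau>) Z"
      unfolding Z_def using plus W(1) unfolding continuous_map by blast
    have "(0, 0) \<in> Z" using W by (simp add: Z_def)
    from Z[unfolded openin_prod_topology_alt, rule_format, OF this]
    obtain P Q where PQ: "openin \<tau> P" "openin \<tau> Q" "0 \<in> P" "0 \<in> Q" "P \<times> Q \<subseteq> Z"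
      by (elim exE conjE)
    have "v + w \<in> W" if "v \<in> P" "w \<in> Q" for v w
    proof -
      have "(v, w) \<in> Z" using PQ(5) that by blast
      then show ?thesis by (simp add: Z_def)
    qed
    have "nbhd_zero \<tau> (P \<inter> Q)" using PQ unfolding nbhd_zero_def by (intro exI[of _ "P \<inter> Q"]) auto
    moreover have "\<forall>v\<in>P \<inter> Q. \<forall>w\<in>P \<inter> Q. v + w \<in> U" using \<open>\<And>v w. v \<in> P \<Longrightarrow> w \<in> Q \<Longrightarrow> v + w \<in> W\<close> W(3) by blast
    ultimately show ?thesis by blast
  qed
  have nminus: "nbhd_zero \<tau> {y. - y \<in> U}" if U: "nbhd_zero \<tau> U" for U
  proof -
    obtain W where "openin \<tau> W" "0 \<in> W" "W \<subseteq> U" using U unfolding nbhd_zero_def by blast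
    then show ?thesis unfolding nbhd_zero_def by (intro exI[of _ "{y. - y \<in> W}"]) (auto intro: uminus)
  qed
  have nscale: "nbhd_zero \<tau> {y. y * x \<in> U}" if U: "nbhd_zero \<tau> U" for x U
  proof -
    obtain W where "openin \<tau> W" "0 \<in> W" "W \<subseteq> U" using U unfolding nbhd_zero_def by blast
    then show ?thesis unfolding nbhd_zero_def by (intro exI[of _ "{y. y * x \<in> W}"]) (auto intro: scale)
  qed
  have nonzero: "\<exists>u\<in>U. u \<noteq> 0" if U: "nbhd_zero \<tau> U" for U
  proof (rule ccontr)
    assume "\<not> (\<exists>u\<in>U. u \<noteq> 0)"
    moreover obtain W where W: "openin \<tau> W" "0 \<in> W" "W \<subseteq> U" using U unfolding nbhd_zero_def by blast
    ultimately have "W = {0}" by blast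
    have "openin \<tau> {x}" for x
    proof -
      have "{y. - x + y \<in> {0}} = {x}" using neg_eq_iff_add_eq_0[of "- x"] by auto
      then show ?thesis using shift[of "{0}" "- x"] W(1) \<open>W = {0}\<close> by simp
    qed
    then have "discrete_topology UNIV = \<tau>" by (simp add: discrete_topology_unique)
    then show False using disc by simp
  qed
  have bone: "bounded_in \<tau> {1}" unfolding bounded_in_def by auto
  have bminus: "bounded_in \<tau> {y. - y \<in> B}" if B: "bounded_in \<tau> B" for B
    unfolding bounded_in_def
  proof (intro allI impI)
    fix U assume "nbhd_zero \<tau> U"
    then have "nbhd_zero \<tau> {y. - y \<in> U}" by (rule nminus)
    then obtain V where V: "nbhd_zero \<tau> V" "{v * b | v b. v \<in> V \<and> b \<in> B} \<subseteq> {y. - y \<in> U}"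
      using B unfolding bounded_in_def by blast
    have "v * b \<in> U" if "v \<in> V" "- b \<in> B" for v b
    proof -
      have "v * (- b) \<in> {y. - y \<in> U}" using V(2) that by blast
      then show ?thesis by simp
    qed
    then show "\<exists>V. nbhd_zero \<tau> V \<and> {v * b |v b. v \<in> V \<and> b \<in> {y. - y \<in> B}} \<subseteq> U"
      using V(1) by blast
  qed
  \<comment> \<open>The bounded neighbourhood \<open>U0\<close> is normalised to be symmetric and to
    contain 1; this preserves boundedness.\<close>
  define A where "A = (U0 \<union> {1}) \<union> {y. - y \<in> U0 \<union> {1}}"
  have bA: "bounded_in \<tau> A" unfolding A_def by (intro bounded_in_Un bminus bone U0)
  have nA: "nbhd_zero \<tau> A" using U0(1) by (rule nbhd_zero_mono) (auto simp: A_def)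
  have into: "\<exists>c. c \<noteq> 0 \<and> (\<forall>a\<in>A. c * a \<in> U)" if U: "nbhd_zero \<tau> U" for U
  proof -
    obtain V where V: "nbhd_zero \<tau> V" "{v * b | v b. v \<in> V \<and> b \<in> A} \<subseteq> U"
      using bA U unfolding bounded_in_def by blast
    then show ?thesis using nonzero[OF V(1)] by blast
  qed
  interpret lb_ball A
  proof
    show "0 \<in> A" using nA unfolding nbhd_zero_def by blast
    show "1 \<in> A" by (simp add: A_def)
    show "- a \<in> A" if "a \<in> A" for a using that by (auto simp: A_def)
    show "\<exists>d. d \<noteq> 0 \<and> (\<forall>a\<in>A. \<forall>b\<in>A. d * (a + b) \<in> A)"
    proof -
      obtain V where V: "nbhd_zero \<tau> V" "\<forall>v\<in>V. \<forall>w\<in>V. v + w \<in> A" using nplus[OF nA] by blast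
      obtain c where "c \<noteq> 0" "\<forall>a\<in>A. c * a \<in> V" using into[OF V(1)] by blast
      then show ?thesis using V(2) by (auto simp: distrib_left)
    qed
    show "\<exists>d. d \<noteq> 0 \<and> (\<forall>a\<in>A. \<forall>b\<in>A. d * (a * b) \<in> A)"
    proof -
      obtain V where V: "nbhd_zero \<tau> V" "{v * b | v b. v \<in> V \<and> b \<in> A} \<subseteq> A"
        using bA nA unfolding bounded_in_def by blast
      obtain c where c: "c \<noteq> 0" "\<forall>a\<in>A. c * a \<in> V" using into[OF V(1)] by blast
      have "c * (a * b) \<in> A" if "a \<in> A" "b \<in> A" for a b
      proof -
        have "(c * a) * b \<in> A" using V(2) c that by blast
        then show ?thesis by (simp add: mult.assoc)
      qed
      then show ?thesis using c(1) by blast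
    qed
    show "\<exists>d. d \<noteq> 0 \<and> (\<forall>a\<in>A. d * a \<in> A \<and> d * a * c \<in> A)" for c
      using into[OF nbhd_zero_Int[OF nA nscale[OF nA, of c]]] by auto
    show "\<exists>c. c \<noteq> 0 \<and> c * x \<notin> A" if x: "x \<noteq> 0" for x
    proof -
      obtain U V where "openin \<tau> U" "openin \<tau> V" "0 \<in> U" "x \<in> V" "disjnt U V"
        using haus x unfolding Hausdorff_space_def by (metis UNIV_I \<open>topspace \<tau> = UNIV\<close>)
      then have "nbhd_zero \<tau> U" "x \<notin> U" unfolding nbhd_zero_def disjnt_def by blast+
      then obtain c where c: "c \<noteq> 0" "\<forall>a\<in>A. c * a \<in> U" using into by blast
      then have "inverse c * x \<notin> A" using \<open>x \<notin> U\<close> by (metis mult.assoc mult_1 right_inverse)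
      then show ?thesis using c(1) by (metis inverse_nonzero_iff_nonzero)
    qed
  qed
  have nb: "nb U \<longleftrightarrow> nbhd_zero \<tau> U" for U
  proof
    assume "nb U"
    then obtain c where c: "c \<noteq> 0" "\<forall>a\<in>A. c * a \<in> U" unfolding nb_def by blast
    have "y \<in> U" if "y * inverse c \<in> A" for y
    proof -
      have "c * (y * inverse c) \<in> U" using c that by blast
      then show ?thesis using c(1) by (simp add: field_simps)
    qed
    then show "nbhd_zero \<tau> U" by (intro nbhd_zero_mono[OF nscale[OF nA, of "inverse c"]]) auto
  next
    assume "nbhd_zero \<tau> U"
    then show "nb U" unfolding nb_def by (rule into)
  qed
  have "openin \<tau> W \<longleftrightarrow> openin (ball_topology A) W" for W
  proof
    assume W: "openin \<tau> W"
    have "nbhd_zero \<tau> {y. x + y \<in> W}" if "x \<in> W" for x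
      unfolding nbhd_zero_def using shift[OF W, of x] that by (intro exI[of _ "{y. x + y \<in> W}"]) auto
    then show "openin (ball_topology A) W" by (simp add: openin_ball_topology nb)
  next
    assume W: "openin (ball_topology A) W"
    show "openin \<tau> W"
    proof (subst openin_subopen, intro ballI)
      fix x assume "x \<in> W"
      then obtain V where V: "openin \<tau> V" "0 \<in> V" "V \<subseteq> {y. x + y \<in> W}"
        using W unfolding openin_ball_topology nb nbhd_zero_def by blast
      have "openin \<tau> {y. - x + y \<in> V}" by (rule shift[OF V(1)])
      moreover have "{y. - x + y \<in> V} \<subseteq> W" using V(3) by force
      ultimately show "\<exists>T. openin \<tau> T \<and> x \<in> T \<and> T \<subseteq> W"
        using V(2) by (intro exI[of _ "{y. - x + y \<in> V}"]) auto
    qed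
  qed
  then show ?thesis using lb_ball_axioms topology_eq by blast
qed

section \<open>Balls that contain x or its inverse for every x\<close>

locale V_ball =
  fixes A :: "'k::field set"
  assumes neg: "a \<in> A \<Longrightarrow> - a \<in> A"
    and add: "\<exists>d. d \<noteq> 0 \<and> (\<forall>a\<in>A. \<forall>b\<in>A. d * (a + b) \<in> A)"
    and mult: "\<exists>d. d \<noteq> 0 \<and> (\<forall>a\<in>A. \<forall>b\<in>A. d * (a * b) \<in> A)"
    and inv: "x \<notin> A \<Longrightarrow> inverse x \<in> A"
    and proper: "A \<noteq> UNIV"

sublocale V_ball \<subseteq> lb_ball
proof
  \<comment> \<open>The convention \<open>inverse 0 = 0\<close> matters: \<open>inv\<close> at 0
    gives membership of 0 itself.\<close>
  show "0 \<in> A" "1 \<in> A" using inv[of 0] inv[of 1] by auto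
  show "\<exists>d. d \<noteq> 0 \<and> (\<forall>a\<in>A. d * a \<in> A \<and> d * a * c \<in> A)" for c
  proof -
    obtain d where d: "d \<noteq> 0" "\<forall>a\<in>A. \<forall>b\<in>A. d * (a * b) \<in> A" using mult by blast
    \<comment> \<open>One of \<open>c\<close> and \<open>1/c\<close> lies in \<open>A\<close>;
      accordingly 1 or \<open>1/c\<close> serves as \<open>x\<close>.\<close>
    obtain x where x: "x \<noteq> 0" "x \<in> A" "x * c \<in> A"
    proof (cases "c \<in> A")
      case True
      then show thesis using that[of 1] \<open>1 \<in> A\<close> by auto
    next
      case False
      then have "c \<noteq> 0" using \<open>0 \<in> A\<close> by blast
      then show thesis using that[of "inverse c"] inv[OF False] \<open>1 \<in> A\<close> by auto
    qed
    have "d * x * a \<in> A \<and> d * x * a * c \<in> A" if "a \<in> A" for a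
    proof -
      have "d * (x * a) \<in> A" "d * (x * c * a) \<in> A" using d x that by blast+
      then show ?thesis by (simp add: mult_ac)
    qed
    then show ?thesis using d x by (metis mult_eq_0_iff)
  qed
  show "\<exists>c. c \<noteq> 0 \<and> c * x \<notin> A" if "x \<noteq> 0" for x
  proof -
    obtain y where "y \<notin> A" using proper by blast
    moreover from this have "y \<noteq> 0" using \<open>0 \<in> A\<close> by blast
    ultimately show ?thesis using that by (intro exI[of _ "y / x"]) auto
  qed
qed (fact neg add mult)+

context V_ball
begin

text \<open>Outside a multiple of \<open>A\<close> the axiom \<open>inv\<close> bounds inverses, and
  separation keeps \<open>x + d\<close> outside such a multiple for all small
  \<open>d\<close>.\<close>

lemma inverse_bounded_near:
  assumes "x \<noteq> 0"
  shows "\<exists>V C. nb V \<and> bd C \<and> (\<forall>d\<in>V. x + d \<noteq> 0 \<and> inverse (x + d) \<in> C)"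
proof -
  obtain c where c: "c \<noteq> 0" "c * x \<notin> A" using sep_ball[OF assms] by blast
  obtain P where P: "nb P" "\<forall>v\<in>P. \<forall>w\<in>P. v + w \<in> {z. c * z \<in> A}"
    using nb_plus[OF nb_scale[OF nb_A c(1)]] by blast
  obtain g where g: "g \<noteq> 0" "\<forall>a\<in>A. g * a \<in> P" using P(1) unfolding nb_def by blast
  have "x + d \<noteq> 0 \<and> inverse (x + d) \<in> (*) (inverse g) ` A" if "d \<in> {d. - d \<in> P}" for d
  proof -
    have 1: "x + d \<notin> P"
    proof
      assume "x + d \<in> P"
      then have "x + d + - d \<in> {z. c * z \<in> A}" using P(2) that by blast
      then show False using c by simp
    qed
    have "inverse g * (x + d) \<notin> A"
    proof
      assume "inverse g * (x + d) \<in> A"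
      then have "g * (inverse g * (x + d)) \<in> P" using g by blast
      then show False using 1 g(1) by (simp flip: mult.assoc)
    qed
    then have "inverse (inverse g * (x + d)) \<in> A" by (rule inv)
    then have "g * inverse (x + d) \<in> A" by simp
    then have "inverse g * (g * inverse (x + d)) \<in> (*) (inverse g) ` A" by blast
    moreover have "x + d \<noteq> 0" using 1 nb_zero[OF P(1)] by auto
    ultimately show ?thesis using g(1) by (simp flip: mult.assoc)
  qed
  then show ?thesis using nb_uminus[OF P(1)] bd_ball by blast
qed

text \<open>The difference of \<open>inverse (x + d)\<close> and \<open>inverse x\<close> is
  \<open>d\<close> times a bounded factor, by \<open>inverse_bounded_near\<close>.\<close>

lemma field_topology_ball_topology: "field_topology (ball_topology A)"
  unfolding field_topology_def continuous_map
proof (intro conjI allI impI lb_ring_topology_ball_topology)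
  let ?T = "ball_topology A"
  show "inverse ` topspace (subtopology ?T (UNIV - {0})) \<subseteq> topspace ?T"
    by (simp add: topspace_ball_topology)
  fix U assume U: "openin ?T U"
  have "openin ?T {x. x \<noteq> 0 \<and> inverse x \<in> U}"
    unfolding openin_ball_topology
  proof
    fix x assume "x \<in> {x. x \<noteq> 0 \<and> inverse x \<in> U}"
    then have x: "x \<noteq> 0" "inverse x \<in> U" by auto
    obtain V C where V: "nb V" "bd C" "\<forall>d\<in>V. x + d \<noteq> 0 \<and> inverse (x + d) \<in> C"
      using inverse_bounded_near[OF x(1)] by blast
    have "nb {y. inverse x + y \<in> U}" using U x unfolding openin_ball_topology by blast
    then obtain W where W: "nb W" "\<forall>w\<in>W. \<forall>z\<in>C * {- inverse x}. w * z \<in> {y. inverse x + y \<in> U}"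
      using nb_mult[OF _ bd_times[OF V(2) bd_singleton]] by blast
    have "x + d \<in> {x. x \<noteq> 0 \<and> inverse x \<in> U}" if d: "d \<in> V \<inter> W" for d
    proof -
      have nz: "x + d \<noteq> 0" "inverse (x + d) \<in> C" using V d by auto
      then have "inverse (x + d) * (- inverse x) \<in> C * {- inverse x}" by (blast intro: set_times_intro)
      then have "inverse x + d * (inverse (x + d) * (- inverse x)) \<in> U" using W d by blast
      moreover have "inverse x + d * (inverse (x + d) * (- inverse x)) = inverse (x + d)"
        using inverse_diff_inverse[OF x(1) nz(1)] by (simp add: algebra_simps)
      ultimately show ?thesis using nz by simp
    qed
    then show "nb {y. x + y \<in> {x. x \<noteq> 0 \<and> inverse x \<in> U}}"
      by (intro nb_mono[OF nb_Int[OF V(1) W(1)]]) auto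
  qed
  moreover have "{x \<in> topspace (subtopology ?T (UNIV - {0})). inverse x \<in> U}
      = {x. x \<noteq> 0 \<and> inverse x \<in> U} \<inter> (UNIV - {0})"
    by (auto simp: topspace_ball_topology)
  ultimately show "openin (subtopology ?T (UNIV - {0}))
      {x \<in> topspace (subtopology ?T (UNIV - {0})). inverse x \<in> U}"
    unfolding openin_subtopology by blast
qed

end

section \<open>V-topologies\<close>


lemma ball_topology_cong:
  fixes A B :: "'k::field set"
  assumes "c \<noteq> 0" "\<And>x. x \<in> A \<Longrightarrow> c * x \<in> B" "d \<noteq> 0" "\<And>x. x \<in> B \<Longrightarrow> d * x \<in> A"
  shows "ball_topology A = ball_topology B"
proof -
  have *: "\<exists>c. c \<noteq> 0 \<and> (\<forall>b\<in>B. x + c * b \<in> W)"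
    if e: "e \<noteq> 0" "\<forall>a\<in>A. x + e * a \<in> W" and d: "d \<noteq> 0" "\<And>x. x \<in> B \<Longrightarrow> d * x \<in> A"
    for x e d W and A B :: "'k set"
  proof -
    have "x + (e * d) * b \<in> W" if "b \<in> B" for b
    proof -
      have "x + e * (d * b) \<in> W" using e d that by blast
      then show ?thesis by (simp add: mult.assoc)
    qed
    then show ?thesis using e(1) d(1) by (intro exI[of _ "e * d"]) auto
  qed
  have "(\<exists>e. e \<noteq> 0 \<and> (\<forall>a\<in>A. x + e * a \<in> W)) \<longleftrightarrow> (\<exists>e. e \<noteq> 0 \<and> (\<forall>b\<in>B. x + e * b \<in> W))" for x W
    using *[of _ A x W d B, OF _ _ assms(3,4)] *[of _ B x W c A, OF _ _ assms(1,2)] by blast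
  then show ?thesis unfolding ball_topology_def by simp
qed

context lb_ball
begin

lemma openin_ball_topology':
  "openin (ball_topology A) W \<longleftrightarrow> (\<forall>x\<in>W. \<exists>c. c \<noteq> 0 \<and> (\<forall>a\<in>A. x + c * a \<in> W))"
  unfolding openin_ball_topology nb_def by simp

end

subsection \<open>Absolute values from multiplicative functions\<close>

text \<open>Artin's criterion: for a multiplicative function the weak inequality with constant 2
  already implies the triangle inequality.\<close>

locale quasi_absolute_value =
  fixes f :: "'k::field \<Rightarrow> real"
  assumes nonneg: "f x \<ge> 0"
    and zero_iff: "f x = 0 \<longleftrightarrow> x = 0"
    and mult: "f (x * y) = f x * f y"
    and quasi_add: "f (x + y) \<le> 2 * max (f x) (f y)"
begin

lemma f_one: "f 1 = 1"
  using mult[of 1 1] zero_iff[of 1] by simp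

lemma f_power: "f (x ^ k) = f x ^ k"
  by (induction k) (simp_all add: f_one mult)

text \<open>Halving the sum repeatedly: each of the \<open>k\<close> levels costs one factor 2, so
  the loss is no worse than the number of terms.\<close>

lemma sum_power_two:
  assumes "\<And>i. i < (2::nat) ^ k \<Longrightarrow> f (a i) \<le> M"
  shows "f (\<Sum>i<2 ^ k. a i) \<le> 2 ^ k * M"
  using assms
proof (induction k arbitrary: a)
  case 0
  have "{..<(2::nat) ^ 0} = {0}" by auto
  then show ?case using 0[of 0] by simp
next
  case (Suc k)
  have "(\<Sum>i<2 ^ Suc k. a i) = (\<Sum>i<2 ^ k. a i) + (\<Sum>i=2 ^ k..<2 ^ Suc k. a i)"
    by (simp only: lessThan_atLeast0) (rule sum.atLeastLessThan_concat[symmetric]; simp)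
  also have "(\<Sum>i=2 ^ k..<2 ^ Suc k. a i) = (\<Sum>i<2 ^ k. a (i + 2 ^ k))"
    using sum.shift_bounds_nat_ivl[of a 0 "2 ^ k" "2 ^ k"] by (simp add: lessThan_atLeast0 mult_2)
  finally have "f (\<Sum>i<2 ^ Suc k. a i) \<le> 2 * max (f (\<Sum>i<2 ^ k. a i)) (f (\<Sum>i<2 ^ k. a (i + 2 ^ k)))"
    using quasi_add by simp
  also have "f (\<Sum>i<2 ^ k. a i) \<le> 2 ^ k * M" using Suc.prems by (intro Suc.IH) simp
  moreover have "f (\<Sum>i<2 ^ k. a (i + 2 ^ k)) \<le> 2 ^ k * M" using Suc.prems by (intro Suc.IH) simp
  ultimately show ?case by simp
qed

lemma sum_bound:
  assumes "\<And>i. i < (N::nat) \<Longrightarrow> f (a i) \<le> M" "N > 0"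
  shows "f (\<Sum>i<N. a i) \<le> 2 * N * M"
proof -
  have M: "M \<ge> 0" using assms(1)[OF assms(2)] nonneg order_trans by blast
  obtain k where k: "2 ^ k \<le> N" "N < 2 ^ (k + 1)" using ex_power_ivl1[of 2 N] assms(2) by auto
  \<comment> \<open>Padding with zeros to the next power of two at most doubles the number of terms;
    hence the factor 2 in the bound.\<close>
  define b where "b i = (if i < N then a i else 0)" for i
  have "(\<Sum>i<N. a i) = (\<Sum>i<2 ^ (k + 1). b i)"
    unfolding b_def using k by (intro sum.mono_neutral_cong_left) auto
  moreover have "f (\<Sum>i<2 ^ (k + 1). b i) \<le> 2 ^ (k + 1) * M"
    by (rule sum_power_two) (use assms M zero_iff[of 0] in \<open>auto simp: b_def\<close>)
  moreover have "2 ^ (k + 1) \<le> 2 * real N"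
    using of_nat_mono[OF k(1), where 'a = real] by simp
  then have "2 ^ (k + 1) * M \<le> 2 * N * M" using M by (intro mult_right_mono) auto
  ultimately show ?thesis by simp
qed

lemma f_of_nat: "f (of_nat m) \<le> 2 * m"
proof (cases "m = 0")
  case True
  then show ?thesis using zero_iff[of 0] by simp
next
  case False
  then show ?thesis using sum_bound[of m "\<lambda>_. 1" 1] by (simp add: f_one)
qed

text \<open>The bound \<open>f (x + y) ^ N \<le> 4 (N + 1) (f x + f y) ^ N\<close> comes from the binomial expansion;
  \<open>N\<close>-th roots remove the factor \<open>4 (N + 1)\<close>.\<close>

lemma triangle: "f (x + y) \<le> f x + f y"
proof (rule ccontr)
  assume "\<not> f (x + y) \<le> f x + f y"
  then have less: "f x + f y < f (x + y)" by simp
  define s t where "s = f x + f y" and "t = f (x + y)"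
  have s: "0 \<le> s" "s < t" using nonneg[of x] nonneg[of y] less by (auto simp: s_def t_def)
  have bound: "t ^ N \<le> 4 * (N + 1) * s ^ N" for N
  proof -
    have "f (of_nat (N choose i) * x ^ i * y ^ (N - i)) \<le> 2 * s ^ N" if i: "i < Suc N" for i
    proof -
      have le: "real (N choose i) * f x ^ i * f y ^ (N - i) \<le> s ^ N"
        unfolding s_def binomial_ring
        by (rule member_le_sum) (use i nonneg in auto)
      have "f (of_nat (N choose i) * x ^ i * y ^ (N - i))
          \<le> 2 * real (N choose i) * f x ^ i * f y ^ (N - i)"
        unfolding mult f_power using f_of_nat nonneg
        by (intro mult_right_mono zero_le_power) auto
      then show ?thesis using le by (simp add: mult.assoc)
    qed
    then have "f (\<Sum>i<Suc N. of_nat (N choose i) * x ^ i * y ^ (N - i)) \<le> 2 * real (Suc N) * (2 * s ^ N)"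
      by (intro sum_bound) auto
    then show ?thesis unfolding t_def f_power[symmetric] binomial_ring
      by (simp add: lessThan_Suc_atMost algebra_simps)
  qed
  show False
  proof (cases "s = 0")
    case True
    then show False using bound[of 1] s by simp
  next
    case False
    define r where "r = s / t"
    have r: "0 \<le> r" "r < 1" using s False by (auto simp: r_def)
    \<comment> \<open>In place of taking roots, the bound is divided by \<open>t ^ N\<close>: 1
      would be at most \<open>4 * (N + 1) * r ^ N\<close>, which tends to 0.\<close>
    have "(\<lambda>N. 4 * (real N * r ^ N) + 4 * r ^ N) \<longlonglongrightarrow> 4 * 0 + 4 * 0"
      using r by (intro tendsto_add tendsto_mult tendsto_const powser_times_n_limit_0 LIMSEQ_power_zero) auto
    moreover have "1 \<le> 4 * (real N * r ^ N) + 4 * r ^ N" for N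
    proof -
      have "1 \<le> 4 * (N + 1) * s ^ N / t ^ N" using bound[of N] s by (simp add: field_simps)
      then show ?thesis by (simp add: r_def power_divide algebra_simps add_divide_distrib)
    qed
    ultimately have "1 \<le> 4 * 0 + 4 * (0::real)" by (intro LIMSEQ_le_const) auto
    then show False by simp
  qed
qed

lemma absolute_value: "absolute_value f"
  unfolding absolute_value_def using nonneg zero_iff mult triangle by blast

end

subsection \<open>The valuation of a valuation ring\<close>

locale proper_valuation_ring =
  fixes E :: "'k::field set"
  assumes one: "1 \<in> E"
    and neg: "x \<in> E \<Longrightarrow> - x \<in> E"
    and add: "x \<in> E \<Longrightarrow> y \<in> E \<Longrightarrow> x + y \<in> E"
    and mult: "x \<in> E \<Longrightarrow> y \<in> E \<Longrightarrow> x * y \<in> E"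
    and inv: "x \<notin> E \<Longrightarrow> inverse x \<in> E"
    and proper: "E \<noteq> UNIV"

sublocale proper_valuation_ring \<subseteq> V_ball E
  by standard (use neg add mult inv proper in \<open>auto intro: exI[of _ 1]\<close>)

context proper_valuation_ring
begin

text \<open>The value group is the multiplicative group modulo the units of \<open>E\<close>. Cosets
  as values give it the type that \<open>V_topology\<close> prescribes, and setwise multiplication
  is its operation.\<close>

definition unit_coset :: "'k \<Rightarrow> 'k set" where
  "unit_coset x = {y. \<exists>u. u \<noteq> 0 \<and> u \<in> E \<and> inverse u \<in> E \<and> y = x * u}"

definition value_group :: "'k set monoid" where
  "value_group = \<lparr>carrier = unit_coset ` (UNIV - {0}), monoid.mult = (*), one = unit_coset 1\<rparr>"

definition value_le :: "('k set \<times> 'k set) set" where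
  "value_le = {(unit_coset x, unit_coset y) | x y. x \<noteq> 0 \<and> y \<noteq> 0 \<and> y / x \<in> E}"

lemma unit_coset_mult: "unit_coset x * unit_coset y = unit_coset (x * y)"
proof
  show "unit_coset x * unit_coset y \<subseteq> unit_coset (x * y)"
  proof
    fix z assume "z \<in> unit_coset x * unit_coset y"
    then obtain u w where u: "u \<noteq> 0" "u \<in> E" "inverse u \<in> E" "w \<noteq> 0" "w \<in> E" "inverse w \<in> E"
      "z = (x * u) * (y * w)" unfolding set_times_def unit_coset_def by blast
    then have "u * w \<noteq> 0" "u * w \<in> E" "inverse (u * w) \<in> E" "z = x * y * (u * w)"
      using mult by (auto simp: mult_ac)
    then show "z \<in> unit_coset (x * y)" unfolding unit_coset_def by blast
  qed
  show "unit_coset (x * y) \<subseteq> unit_coset x * unit_coset y"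
  proof
    fix z assume "z \<in> unit_coset (x * y)"
    then obtain u where u: "u \<noteq> 0" "u \<in> E" "inverse u \<in> E" "z = (x * 1) * (y * u)"
      unfolding unit_coset_def by (auto simp: mult_ac)
    have "x * 1 \<in> unit_coset x" "y * u \<in> unit_coset y"
      unfolding unit_coset_def using u one by (auto intro: exI[of _ 1])
    then show "z \<in> unit_coset x * unit_coset y" unfolding u(4) by (rule set_times_intro)
  qed
qed

lemma unit_coset_eqD:
  assumes "unit_coset x = unit_coset y" "x \<noteq> 0"
  shows "\<exists>u. u \<noteq> 0 \<and> u \<in> E \<and> inverse u \<in> E \<and> x = y * u"
proof -
  have "x * 1 \<in> unit_coset x" unfolding unit_coset_def using one by (auto intro: exI[of _ 1])
  then show ?thesis using assms unfolding unit_coset_def by simp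
qed

lemma unit_coset_eqI:
  assumes "x \<noteq> 0" "y \<noteq> 0" "x / y \<in> E" "y / x \<in> E"
  shows "unit_coset x = unit_coset y"
proof -
  have "unit_coset (y * (x / y)) = unit_coset y * unit_coset (x / y)" by (simp only: unit_coset_mult)
  moreover have "unit_coset (x / y) = unit_coset 1"
  proof -
    have *: "unit_coset u \<subseteq> unit_coset 1" if "u \<noteq> 0" "u \<in> E" "inverse u \<in> E" for u
      unfolding unit_coset_def
    proof clarify
      fix w assume "w \<noteq> 0" "w \<in> E" "inverse w \<in> E"
      then show "\<exists>v. v \<noteq> 0 \<and> v \<in> E \<and> inverse v \<in> E \<and> u * w = 1 * v"
        using that mult by (intro exI[of _ "u * w"]) auto
    qed
    have u: "x / y \<noteq> 0" "inverse (x / y) \<in> E" using assms by auto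
    have "unit_coset 1 = unit_coset (x / y) * unit_coset (inverse (x / y))"
      using u by (simp add: unit_coset_mult)
    also have "\<dots> \<subseteq> unit_coset (x / y) * unit_coset 1"
      using *[of "inverse (x / y)"] u assms by (intro set_times_mono2) auto
    also have "\<dots> = unit_coset (x / y)" by (simp add: unit_coset_mult)
    finally show ?thesis using *[of "x / y"] u assms by auto
  qed
  ultimately show ?thesis using assms by (simp add: unit_coset_mult)
qed

text \<open>Independence of representatives: these differ by units of \<open>E\<close>, and so do
  the quotients.\<close>

lemma value_le_iff:
  assumes "x \<noteq> 0" "y \<noteq> 0" shows "(unit_coset x, unit_coset y) \<in> value_le \<longleftrightarrow> y / x \<in> E"
proof
  assume "(unit_coset x, unit_coset y) \<in> value_le"
  then obtain x' y' where *: "x' \<noteq> 0" "y' \<noteq> 0" "y' / x' \<in> E"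
    "unit_coset x = unit_coset x'" "unit_coset y = unit_coset y'" unfolding value_le_def by blast
  obtain u where u: "u \<noteq> 0" "u \<in> E" "inverse u \<in> E" "x = x' * u"
    using unit_coset_eqD[OF *(4) assms(1)] by blast
  obtain w where w: "w \<noteq> 0" "w \<in> E" "inverse w \<in> E" "y = y' * w"
    using unit_coset_eqD[OF *(5) assms(2)] by blast
  have "y / x = y' / x' * (w * inverse u)" unfolding u(4) w(4) by (simp add: field_simps)
  also have "\<dots> \<in> E" by (intro mult * u w)
  finally show "y / x \<in> E" .
next
  assume "y / x \<in> E"
  then show "(unit_coset x, unit_coset y) \<in> value_le" unfolding value_le_def using assms by blast
qed

lemma nontrivial_valuation_unit_coset: "nontrivial_valuation value_group value_le unit_coset"
proof -
  have [simp]: "carrier value_group = unit_coset ` (UNIV - {0})" "\<one>\<^bsub>value_group\<^esub> = unit_coset 1"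
    "x \<otimes>\<^bsub>value_group\<^esub> y = x * y" for x y
    by (simp_all add: value_group_def)
  have "comm_group value_group"
  proof (rule comm_groupI)
    fix x assume "x \<in> carrier value_group"
    then obtain a where a: "a \<noteq> 0" "x = unit_coset a" by auto
    then have "unit_coset (inverse a) \<otimes>\<^bsub>value_group\<^esub> x = \<one>\<^bsub>value_group\<^esub>" by (simp add: unit_coset_mult)
    moreover have "unit_coset (inverse a) \<in> carrier value_group" using a by simp
    ultimately show "\<exists>y\<in>carrier value_group. y \<otimes>\<^bsub>value_group\<^esub> x = \<one>\<^bsub>value_group\<^esub>" by blast
  next
    fix x y assume "x \<in> carrier value_group" "y \<in> carrier value_group"
    then show "x \<otimes>\<^bsub>value_group\<^esub> y \<in> carrier value_group" by (auto simp: unit_coset_mult)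
  next
    fix x assume "x \<in> carrier value_group"
    then show "\<one>\<^bsub>value_group\<^esub> \<otimes>\<^bsub>value_group\<^esub> x = x" by (auto simp: unit_coset_mult)
  next
    fix x y z
    show "x \<otimes>\<^bsub>value_group\<^esub> y \<otimes>\<^bsub>value_group\<^esub> z = x \<otimes>\<^bsub>value_group\<^esub> (y \<otimes>\<^bsub>value_group\<^esub> z)"
      by (simp add: mult.assoc)
    show "x \<otimes>\<^bsub>value_group\<^esub> y = y \<otimes>\<^bsub>value_group\<^esub> x"
      by (simp add: mult.commute)
  qed auto
  moreover have "linear_order_on (carrier value_group) value_le"
    unfolding order_on_defs
  proof (intro conjI)
    show "value_le \<subseteq> carrier value_group \<times> carrier value_group" by (auto simp: value_le_def)
    show "refl_on (carrier value_group) value_le"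
      by (auto simp: refl_on_def value_le_iff one)
    show "trans value_le"
    proof (rule transI)
      fix X Y Z assume XY: "(X, Y) \<in> value_le" and YZ: "(Y, Z) \<in> value_le"
      obtain x y where x: "X = unit_coset x" "Y = unit_coset y" "x \<noteq> 0" "y \<noteq> 0"
        using XY unfolding value_le_def by blast
      obtain z where z: "Z = unit_coset z" "z \<noteq> 0" using YZ unfolding value_le_def by blast
      have "z / y * (y / x) \<in> E" using XY YZ x z by (intro mult) (simp_all add: value_le_iff)
      then show "(X, Z) \<in> value_le" using x z by (simp add: value_le_iff)
    qed
    show "antisym value_le"
    proof (rule antisymI)
      fix X Y assume XY: "(X, Y) \<in> value_le" and YX: "(Y, X) \<in> value_le"
      obtain x y where x: "X = unit_coset x" "Y = unit_coset y" "x \<noteq> 0" "y \<noteq> 0"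
        using XY unfolding value_le_def by blast
      then have "y / x \<in> E" "x / y \<in> E" using XY YX by (simp_all add: value_le_iff)
      then show "X = Y" unfolding x(1,2) by (intro unit_coset_eqI x)
    qed
    show "total_on (carrier value_group) value_le"
    proof (rule total_onI)
      fix X Y assume "X \<in> carrier value_group" "Y \<in> carrier value_group"
      then obtain x y where x: "X = unit_coset x" "Y = unit_coset y" "x \<noteq> 0" "y \<noteq> 0" by auto
      then show "(X, Y) \<in> value_le \<or> (Y, X) \<in> value_le" using inv[of "y / x"] by (auto simp: value_le_iff)
    qed
  qed
  ultimately have "ordered_abelian_group value_group value_le"
    unfolding ordered_abelian_group_def by (auto simp: unit_coset_mult value_le_iff)
  moreover have "(unit_coset x, unit_coset (x + y)) \<in> value_le \<or> (unit_coset y, unit_coset (x + y)) \<in> value_le"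
    if "x \<noteq> 0" "y \<noteq> 0" "x + y \<noteq> 0" for x y
  proof (cases "y / x \<in> E")
    case True
    have "(x + y) / x = 1 + y / x" using that by (simp add: field_simps)
    then show ?thesis using that True one add by (simp add: value_le_iff)
  next
    case False
    then have "x / y \<in> E" using inv by force
    moreover have "(x + y) / y = x / y + 1" using that by (simp add: field_simps)
    ultimately show ?thesis using that one add by (simp add: value_le_iff)
  qed
  ultimately have "valuation value_group value_le unit_coset"
    unfolding valuation_def by (auto simp: unit_coset_mult)
  moreover have "\<exists>x. x \<noteq> 0 \<and> unit_coset x \<noteq> \<one>\<^bsub>value_group\<^esub>"
  proof -
    obtain x where x: "x \<notin> E" using proper by blast
    then have "x \<noteq> 0" using zero_mem by blast
    moreover have "unit_coset x \<noteq> unit_coset 1" using unit_coset_eqD[of x 1] x \<open>x \<noteq> 0\<close> by auto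
    ultimately show ?thesis by auto
  qed
  ultimately show ?thesis unfolding nontrivial_valuation_def by blast
qed

text \<open>\<open>valuation_ball\<close> is an open ball, while multiples of \<open>E\<close> are
  closed ones. An element \<open>q\<close> outside \<open>E\<close> has negative value, so the
  closed ball of radius \<open>c / q\<close> lies in the open ball of radius
  \<open>c\<close>.\<close>

lemma induced_by_unit_coset:
  "induced_by_valuation value_group value_le unit_coset (ball_topology E)"
  unfolding induced_by_valuation_def openin_ball_topology'
proof (intro allI ball_cong refl)
  fix U x
  have ball: "valuation_ball value_le unit_coset x (unit_coset c)
      = {y. y = x \<or> ((y - x) / c \<in> E \<and> unit_coset c \<noteq> unit_coset (y - x))}" if "c \<noteq> 0" for c
    unfolding valuation_ball_def using value_le_iff[OF that] by force
  obtain q where q: "q \<notin> E" using proper by blast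
  then have q0: "q \<noteq> 0" using zero_mem by blast
  show "(\<exists>c. c \<noteq> 0 \<and> (\<forall>a\<in>E. x + c * a \<in> U)) \<longleftrightarrow>
      (\<exists>\<gamma>\<in>carrier value_group. valuation_ball value_le unit_coset x \<gamma> \<subseteq> U)"
  proof
    assume "\<exists>c. c \<noteq> 0 \<and> (\<forall>a\<in>E. x + c * a \<in> U)"
    then obtain c where c: "c \<noteq> 0" "\<forall>a\<in>E. x + c * a \<in> U" by blast
    have "y \<in> U" if "y = x \<or> (y - x) / c \<in> E" for y
    proof -
      have "(y - x) / c \<in> E" using that zero_mem by auto
      then have "x + c * ((y - x) / c) \<in> U" using c by blast
      then show ?thesis using c by simp
    qed
    then have "valuation_ball value_le unit_coset x (unit_coset c) \<subseteq> U" unfolding ball[OF c(1)] by blast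
    then show "\<exists>\<gamma>\<in>carrier value_group. valuation_ball value_le unit_coset x \<gamma> \<subseteq> U"
      using c(1) by (auto simp: value_group_def)
  next
    assume "\<exists>\<gamma>\<in>carrier value_group. valuation_ball value_le unit_coset x \<gamma> \<subseteq> U"
    then obtain c where c: "c \<noteq> 0" "valuation_ball value_le unit_coset x (unit_coset c) \<subseteq> U"
      by (auto simp: value_group_def)
    have "x + c / q * a \<in> U" if a: "a \<in> E" for a
    proof -
      have "unit_coset c \<noteq> unit_coset (c / q * a)" if "a \<noteq> 0"
      proof
        assume "unit_coset c = unit_coset (c / q * a)"
        then obtain u where "u \<in> E" "c = c / q * a * u" using unit_coset_eqD[OF _ c(1)] by blast
        then have "q = a * u" using q0 c(1) by (simp add: field_simps)
        then show False using q mult[OF a \<open>u \<in> E\<close>] by simp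
      qed
      moreover have "(c / q * a) / c = inverse q * a" using c(1) q0 by (simp add: field_simps)
      then have "(c / q * a) / c \<in> E" using mult[OF inv[OF q] a] by simp
      ultimately have "x + c / q * a \<in> valuation_ball value_le unit_coset x (unit_coset c)"
        unfolding ball[OF c(1)] by auto
      then show ?thesis using c(2) by blast
    qed
    then show "\<exists>c. c \<noteq> 0 \<and> (\<forall>a\<in>E. x + c * a \<in> U)" using c(1) q0 by (intro exI[of _ "c / q"]) auto
  qed
qed

lemma V_topology_ball_topology: "V_topology (ball_topology E)"
  unfolding V_topology_def
  using field_topology_ball_topology nontrivial_valuation_unit_coset induced_by_unit_coset by blast

end


subsection \<open>The theorem of Kowalsky and Duerbaum\<close>

context V_ball
begin

lemma not_bd_UNIV: "\<not> bd UNIV"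
proof
  assume "bd UNIV"
  then obtain c where c: "c \<noteq> 0" "\<forall>x. c * x \<in> A" unfolding bd_def by blast
  have "x \<in> A" for x using c(2)[rule_format, of "x / c"] c(1) by simp
  then show False using proper by blast
qed

lemma ball_scalar: "\<exists>e. e \<noteq> 0 \<and> (\<forall>a\<in>A. \<forall>b\<in>A. e * (a + b) \<in> A \<and> e * (a * b) \<in> A)"
proof -
  have "bd (A + A \<union> A * A)" by (intro bd_Un bd_plus bd_times bd_A)
  then obtain e where "e \<noteq> 0" "\<forall>x\<in>A + A \<union> A * A. e * x \<in> A" unfolding bd_def by blast
  then show ?thesis by (auto intro!: exI[of _ e])
qed

end

section \<open>Bounded powers: the valuation case\<close>

locale scaled_V_ball = V_ball A for A :: "'k::field set" +
  fixes e :: 'k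
  assumes e0: "e \<noteq> 0"
    and e_add: "a \<in> A \<Longrightarrow> b \<in> A \<Longrightarrow> e * (a + b) \<in> A"
    and e_mult: "a \<in> A \<Longrightarrow> b \<in> A \<Longrightarrow> e * (a * b) \<in> A"
begin

lemma e_power: "x \<in> A \<Longrightarrow> e ^ k * x \<in> A"
proof (induction k)
  case (Suc k)
  then show ?case using e_add[of "e ^ k * x" 0] zero_mem by (simp add: mult.assoc)
qed simp

lemma e_power_mono: 
  assumes "e ^ k * x \<in> A" "k \<le> l" shows "e ^ l * x \<in> A"
proof -
  have "e ^ (l - k) * (e ^ k * x) \<in> A" using e_power[OF assms(1)] .
  then show ?thesis using assms(2) by (simp flip: mult.assoc power_add)
qed

text \<open>The union \<open>E\<close> of all \<open>A / e ^ k\<close> absorbs the factor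
  \<open>e\<close> from \<open>e_add\<close> and \<open>e_mult\<close>, so it is a ring. Bounded
  powers keep \<open>E\<close> bounded, hence equivalent to \<open>A\<close>.\<close>

lemma V_topology_if_bounded_powers:
  assumes "bd (range (\<lambda>k. inverse e ^ k))"
  shows "V_topology (ball_topology A)"
proof -
  define E where "E = {x. \<exists>k. e ^ k * x \<in> A}"
  have AE: "A \<subseteq> E"
  proof
    fix x assume "x \<in> A"
    then have "e ^ 0 * x \<in> A" by simp
    then show "x \<in> E" unfolding E_def by blast
  qed
  have "E \<subseteq> range (\<lambda>k. inverse e ^ k) * A"
  proof
    fix x assume "x \<in> E"
    then obtain k where "e ^ k * x \<in> A" unfolding E_def by blast
    moreover have "x = inverse e ^ k * (e ^ k * x)"
      using e0 by (simp flip: mult.assoc power_mult_distrib)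
    ultimately show "x \<in> range (\<lambda>k. inverse e ^ k) * A" by (metis rangeI set_times_intro)
  qed
  then have bdE: "bd E" using bd_times[OF assms bd_A] bd_subset by blast
  interpret E: proper_valuation_ring E
  proof
    show "1 \<in> E" using AE one_mem by blast
    show "- x \<in> E" if "x \<in> E" for x using that neg_mem unfolding E_def by fastforce
    show "x + y \<in> E" if xy: "x \<in> E" "y \<in> E" for x y
    proof -
      obtain k l where "e ^ k * x \<in> A" "e ^ l * y \<in> A" using xy unfolding E_def by blast
      then have "e ^ max k l * x \<in> A" "e ^ max k l * y \<in> A" using e_power_mono by auto
      then have "e * (e ^ max k l * x + e ^ max k l * y) \<in> A" by (rule e_add)
      then have "e ^ Suc (max k l) * (x + y) \<in> A" by (simp add: algebra_simps)
      then show ?thesis unfolding E_def by blast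
    qed
    show "x * y \<in> E" if xy: "x \<in> E" "y \<in> E" for x y
    proof -
      obtain k l where "e ^ k * x \<in> A" "e ^ l * y \<in> A" using xy unfolding E_def by blast
      then have "e * ((e ^ k * x) * (e ^ l * y)) \<in> A" by (rule e_mult)
      then have "e ^ Suc (k + l) * (x * y) \<in> A" by (simp add: algebra_simps power_add)
      then show ?thesis unfolding E_def by blast
    qed
    show "inverse x \<in> E" if "x \<notin> E" for x using that AE inv by blast
    show "E \<noteq> UNIV" using bdE not_bd_UNIV by auto
  qed
  obtain c where "c \<noteq> 0" "\<forall>x\<in>E. c * x \<in> A" using bdE unfolding bd_def by blast
  then have "ball_topology E = ball_topology A"
    using AE by (intro ball_topology_cong[of c _ _ 1]) auto
  then show ?thesis using E.V_topology_ball_topology by simp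
qed

end

section \<open>Unbounded powers: the absolute value case\<close>

locale archimedean_V_ball = scaled_V_ball +
  assumes unbounded: "\<not> bd (range (\<lambda>k. inverse e ^ k))"
begin

lemma e_powi_mono: 
  assumes "e powi p * x \<in> A" "p \<le> q" shows "e powi q * x \<in> A"
proof -
  have "e ^ nat (q - p) * (e powi p * x) \<in> A" using e_power[OF assms(1)] .
  moreover have "e ^ nat (q - p) * e powi p = e powi q"
    using assms(2) e0 power_int_add[of e "q - p" p] by (simp add: power_int_def)
  ultimately show ?thesis by (simp flip: mult.assoc)
qed

text \<open>Unboundedness is used twice. For \<open>x\<close> it gives a negative exponent at which
  membership fails; for \<open>1/x\<close> it gives, through \<open>inv\<close>, a nonnegative one
  at which it holds. Between the two, membership switches.\<close>

lemma ex_level: assumes "x \<noteq> 0" shows "\<exists>p. e powi p * x \<in> A \<and> e powi (p - 1) * x \<notin> A"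
proof -
  have unb: "\<exists>k. y * inverse e ^ k \<notin> A" if "y \<noteq> 0" for y
    using unbounded that unfolding bd_def by blast
  obtain k where k: "x * inverse e ^ k \<notin> A" using unb[OF assms] by blast
  obtain l where "inverse x * inverse e ^ l \<notin> A" using unb[of "inverse x"] assms by auto
  from inv[OF this] have l: "e ^ l * x \<in> A" by (simp add: power_inverse mult.commute)
  define P where "P i \<longleftrightarrow> e powi (int i - int k) * x \<in> A" for i
  have "\<not> P 0" using k by (simp add: P_def power_int_minus power_inverse mult.commute)
  moreover have "P (l + k)" using l by (simp add: P_def)
  ultimately obtain i where "\<not> P i" "P (Suc i)"
    using ex_least_nat_less[of P "l + k"] by blast
  then show ?thesis unfolding P_def by (intro exI[of _ "int (Suc i) - int k"]) simp
qed

text \<open>\<open>level x\<close> is the least \<open>p\<close> with \<open>x \<in> e\<^sup>-\<^sup>p A\<close> (a junk value for \<open>x = 0\<close>); it is a homomorphism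
  up to a bounded error, and \<open>stable_level\<close> is its homogenization.\<close>

definition level :: "'a \<Rightarrow> int" where
  "level x = (SOME p. e powi p * x \<in> A \<and> e powi (p - 1) * x \<notin> A)"

lemma level_spec: 
  assumes "x \<noteq> 0" shows "e powi level x * x \<in> A" "e powi (level x - 1) * x \<notin> A"
  using someI_ex[OF ex_level[OF assms]] unfolding level_def by blast+

lemma level_le_iff: 
  assumes "x \<noteq> 0" shows "level x \<le> p \<longleftrightarrow> e powi p * x \<in> A"
proof
  assume "level x \<le> p" then show "e powi p * x \<in> A" using e_powi_mono level_spec[OF assms] by blast
next
  assume p: "e powi p * x \<in> A"
  show "level x \<le> p"
  proof (rule ccontr)
    assume "\<not> level x \<le> p"
    then have "e powi (level x - 1) * x \<in> A" by (intro e_powi_mono[OF p]) simp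
    then show False using level_spec[OF assms] by blast
  qed
qed

lemma level_mult_le: 
  assumes "x \<noteq> 0" "y \<noteq> 0" shows "level (x * y) \<le> level x + level y + 1"
proof -
  have "e * ((e powi level x * x) * (e powi level y * y)) \<in> A"
    by (intro e_mult level_spec assms)
  moreover have "e powi (level x + level y + 1) = e * e powi level x * e powi level y"
    using e0 by (simp add: power_int_add mult_ac)
  ultimately show ?thesis using assms by (subst level_le_iff) (simp_all add: mult_ac)
qed

lemma level_inverse_le: 
  assumes "x \<noteq> 0" shows "level (inverse x) \<le> 1 - level x"
proof -
  have "inverse (e powi (level x - 1) * x) \<in> A" by (intro inv level_spec assms)
  moreover have "inverse (e powi (level x - 1)) = e powi (1 - level x)"
    by (simp flip: power_int_minus)
  ultimately show ?thesis using assms by (subst level_le_iff) simp_all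
qed

lemma level_add_le: 
  assumes "x \<noteq> 0" "y \<noteq> 0" "x + y \<noteq> 0" shows "level (x + y) \<le> max (level x) (level y) + 1"
proof -
  let ?m = "max (level x) (level y)"
  have "e * (e powi ?m * x + e powi ?m * y) \<in> A"
    using assms by (intro e_add) (simp_all flip: level_le_iff)
  moreover have "e powi (?m + 1) = e * e powi ?m" using e0 by (simp add: power_int_add mult.commute)
  ultimately show ?thesis using assms by (subst level_le_iff) (simp_all add: algebra_simps)
qed

text \<open>The loss 2 is 1 for the inverse and 1 for the product in
  \<open>x = (x * y) * inverse y\<close>.\<close>

lemma level_mult_ge: 
  assumes "x \<noteq> 0" "y \<noteq> 0" shows "level x + level y - 2 \<le> level (x * y)"
proof -
  have "level (x * y * inverse y) \<le> level (x * y) + level (inverse y) + 1"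
    using assms by (intro level_mult_le) auto
  moreover have "x * y * inverse y = x" using assms by simp
  ultimately show ?thesis using level_inverse_le[OF assms(2)] by simp
qed

definition approx_level :: "'a \<Rightarrow> nat \<Rightarrow> real" where
  "approx_level x k = real_of_int (level (x ^ 2 ^ k)) / 2 ^ k"

definition stable_level :: "'a \<Rightarrow> real" where
  "stable_level x = lim (approx_level x)"

text \<open>Squaring changes twice the level by at most 2; division by \<open>2 ^ Suc k\<close>
  leaves \<open>1 / 2 ^ k\<close>. These steps are summable, which is why exponents run through
  powers of two.\<close>

lemma approx_level_step: 
  assumes "x \<noteq> 0" shows "\<bar>approx_level x (Suc k) - approx_level x k\<bar> \<le> 1 / 2 ^ k"
proof -
  define z where "z = x ^ 2 ^ k"
  have z: "z \<noteq> 0" using assms by (simp add: z_def)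
  have "x ^ 2 ^ Suc k = z * z" by (simp add: z_def mult_2 power_add)
  moreover have "\<bar>level (z * z) - 2 * level z\<bar> \<le> 2"
    using level_mult_le[OF z z] level_mult_ge[OF z z] by simp
  then have "\<bar>real_of_int (level (z * z)) - 2 * real_of_int (level z)\<bar> \<le> 2" by linarith
  ultimately show ?thesis unfolding approx_level_def z_def[symmetric] by (simp add: field_simps)
qed

lemma approx_level_tendsto: 
  assumes "x \<noteq> 0"
  shows "approx_level x \<longlonglongrightarrow> stable_level x" "\<bar>stable_level x - level x\<bar> \<le> 2"
proof -
  \<comment> \<open>The steps from \<open>k\<close> on add up to \<open>2 / 2 ^ k\<close>, so
    \<open>lo\<close> increases and \<open>hi\<close> decreases to the limit; at
    \<open>k = 0\<close> they give the distance 2 from \<open>level\<close>.\<close>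
  define lo where "lo k = approx_level x k - 2 / 2 ^ k" for k
  define hi where "hi k = approx_level x k + 2 / 2 ^ k" for k
  have "incseq lo"
  proof (rule incseq_SucI)
    fix k show "lo k \<le> lo (Suc k)"
      using approx_level_step[OF assms, of k] unfolding lo_def by (simp add: abs_le_iff)
  qed
  have "decseq hi"
  proof (rule decseq_SucI)
    fix k show "hi (Suc k) \<le> hi k"
      using approx_level_step[OF assms, of k] unfolding hi_def by (simp add: abs_le_iff)
  qed
  have "lo k \<le> hi k" for k by (simp add: lo_def hi_def)
  then have "lo k \<le> hi 0" for k using decseqD[OF \<open>decseq hi\<close>, of 0 k] order_trans by blast
  then obtain L where L: "lo \<longlonglongrightarrow> L" using incseq_convergent[OF \<open>incseq lo\<close>] by metis
  have "(\<lambda>k. 2 / 2 ^ k :: real) \<longlonglongrightarrow> 0"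
    using LIMSEQ_divide_realpow_zero[of 2 2] by simp
  then have "(\<lambda>k. lo k + 2 / 2 ^ k) \<longlonglongrightarrow> L + 0" by (rule tendsto_add[OF L])
  then have lim: "approx_level x \<longlonglongrightarrow> L" by (simp add: lo_def)
  then show lim': "approx_level x \<longlonglongrightarrow> stable_level x" unfolding stable_level_def by (simp add: limI)
  then have "(\<lambda>k. approx_level x k + 2 / 2 ^ k) \<longlonglongrightarrow> stable_level x + 0"
    by (rule tendsto_add) fact
  then have hi: "hi \<longlonglongrightarrow> stable_level x" by (simp add: hi_def[abs_def])
  have "lo 0 \<le> stable_level x"
    using incseq_le[OF \<open>incseq lo\<close>] L LIMSEQ_unique[OF lim lim'] by blast
  moreover have "stable_level x \<le> hi 0" using decseq_ge[OF \<open>decseq hi\<close> hi] .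
  ultimately show "\<bar>stable_level x - level x\<bar> \<le> 2"
    by (simp add: lo_def hi_def approx_level_def)
qed

text \<open>\<open>level\<close> is additive up to 2, and on the \<open>2 ^ k\<close>-th powers this
  defect is divided by \<open>2 ^ k\<close>.\<close>

lemma stable_level_mult: 
  assumes "x \<noteq> 0" "y \<noteq> 0" shows "stable_level (x * y) = stable_level x + stable_level y"
proof -
  have "\<bar>approx_level (x * y) k - (approx_level x k + approx_level y k)\<bar> \<le> 2 / 2 ^ k" for k
  proof -
    have nz: "x ^ 2 ^ k \<noteq> 0" "y ^ 2 ^ k \<noteq> 0" using assms by auto
    have "\<bar>level (x ^ 2 ^ k * y ^ 2 ^ k) - (level (x ^ 2 ^ k) + level (y ^ 2 ^ k))\<bar> \<le> 2"
      using level_mult_le[OF nz] level_mult_ge[OF nz] by simp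
    then have "\<bar>real_of_int (level ((x * y) ^ 2 ^ k))
        - (real_of_int (level (x ^ 2 ^ k)) + real_of_int (level (y ^ 2 ^ k)))\<bar> \<le> 2"
      unfolding power_mult_distrib by linarith
    from divide_right_mono[OF this, of "2 ^ k"]
    have "\<bar>(real_of_int (level ((x * y) ^ 2 ^ k))
        - (real_of_int (level (x ^ 2 ^ k)) + real_of_int (level (y ^ 2 ^ k)))) / 2 ^ k\<bar> \<le> 2 / 2 ^ k"
      by (simp add: abs_divide)
    then show ?thesis unfolding approx_level_def by (simp add: diff_divide_distrib add_divide_distrib)
  qed
  then have "(\<lambda>k. \<bar>approx_level (x * y) k - (approx_level x k + approx_level y k)\<bar>) \<longlonglongrightarrow> 0"
    by (intro real_tendsto_sandwich[OF _ _ tendsto_const LIMSEQ_divide_realpow_zero[of 2 2]] always_eventually) auto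
  then have "(\<lambda>k. approx_level (x * y) k - (approx_level x k + approx_level y k)) \<longlonglongrightarrow> 0"
    by (rule tendsto_rabs_zero_cancel)
  moreover have "(\<lambda>k. approx_level (x * y) k - (approx_level x k + approx_level y k))
      \<longlonglongrightarrow> stable_level (x * y) - (stable_level x + stable_level y)"
    using assms by (intro tendsto_diff tendsto_add approx_level_tendsto) auto
  ultimately have "0 = stable_level (x * y) - (stable_level x + stable_level y)" by (rule LIMSEQ_unique)
  then show ?thesis by simp
qed

text \<open>The constant is 2 + 1 + 2: passing to \<open>level\<close>, the defect of
  \<open>level_add_le\<close>, and passing back.\<close>

lemma stable_level_add: 
  assumes "x \<noteq> 0" "y \<noteq> 0" "x + y \<noteq> 0"
  shows "stable_level (x + y) \<le> max (stable_level x) (stable_level y) + 5"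
  using approx_level_tendsto(2)[OF assms(1)] approx_level_tendsto(2)[OF assms(2)]
    approx_level_tendsto(2)[OF assms(3)] level_add_le[OF assms] by linarith

text \<open>The base \<open>2\<^sup>1\<^sup>/\<^sup>5\<close> turns the additive error 5 into the factor 2 of the triangle inequality lemma.\<close>

definition level_abs :: "'a \<Rightarrow> real" where
  "level_abs x = (if x = 0 then 0 else 2 powr (stable_level x / 5))"

lemma quasi_absolute_value_level_abs: "quasi_absolute_value level_abs"
proof
  fix x y
  show "level_abs x \<ge> 0" "level_abs x = 0 \<longleftrightarrow> x = 0" by (auto simp: level_abs_def)
  show "level_abs (x * y) = level_abs x * level_abs y"
    by (simp add: level_abs_def stable_level_mult powr_add add_divide_distrib)
  show "level_abs (x + y) \<le> 2 * max (level_abs x) (level_abs y)"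
  proof (cases "x = 0 \<or> y = 0 \<or> x + y = 0")
    case True
    then show ?thesis by (auto simp: level_abs_def le_max_iff_disj)
  next
    case False
    have "2 powr (stable_level (x + y) / 5) \<le> 2 powr (max (stable_level x) (stable_level y) / 5 + 1)"
      using stable_level_add[of x y] False by (intro powr_mono) auto
    also have "\<dots> = 2 * max (2 powr (stable_level x / 5)) (2 powr (stable_level y / 5))"
      by (simp add: powr_add max_def)
    finally show ?thesis using False by (simp add: level_abs_def)
  qed
qed

text \<open>A trivial value would bound all levels by 2, and the whole field would lie in one
  multiple of \<open>A\<close>.\<close>

lemma nontrivial_level_abs: "\<exists>x. x \<noteq> 0 \<and> level_abs x \<noteq> 1"
proof (rule ccontr)
  assume "\<not> (\<exists>x. x \<noteq> 0 \<and> level_abs x \<noteq> 1)"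
  then have "stable_level x = 0" if "x \<noteq> 0" for x
    using that powr_eq_one_iff_gen[of 2 "stable_level x / 5"] by (fastforce simp: level_abs_def)
  then have "level x \<le> 2" if "x \<noteq> 0" for x using approx_level_tendsto(2)[OF that] that by simp
  then have *: "e powi 2 * x \<in> A" if "x \<noteq> 0" for x using level_le_iff that by blast
  have "e powi 2 * x \<in> A" for x using * zero_mem by (cases "x = 0") auto
  then have "bd UNIV" unfolding bd_def using e0 by (intro exI[of _ "e powi 2"]) auto
  then show False using not_bd_UNIV by blast
qed

lemma induced_by_level_abs: "induced_by_absolute_value level_abs (ball_topology A)"
  unfolding induced_by_absolute_value_def openin_ball_topology'
proof (intro allI ball_cong refl iffI)
  fix U x assume "\<exists>c. c \<noteq> 0 \<and> (\<forall>a\<in>A. x + c * a \<in> U)"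
  then obtain c where c: "c \<noteq> 0" "\<forall>a\<in>A. x + c * a \<in> U" by blast
  \<comment> \<open>The 3 covers the distance 2 between \<open>stable_level\<close> and
    \<open>level\<close> and the defect 1 of \<open>level_mult_le\<close>, so that
    \<open>z / c\<close> gets level at most 0.\<close>
  define \<epsilon> where "\<epsilon> = 2 powr ((- 3 - level (inverse c)) / 5)"
  have "y \<in> U" if y: "level_abs (y - x) < \<epsilon>" for y
  proof -
    define z where "z = y - x"
    have "z / c \<in> A"
    proof (cases "z = 0")
      case False
      then have "stable_level z < - 3 - level (inverse c)"
        using y by (simp add: level_abs_def \<epsilon>_def z_def)
      then have "level z + level (inverse c) + 1 \<le> 0" using approx_level_tendsto(2)[OF False] by linarith
      then have "level (z * inverse c) \<le> 0" using level_mult_le[OF False, of "inverse c"] c(1) by simp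
      then show ?thesis using level_le_iff[of "z * inverse c" 0] False c(1) by (simp add: divide_inverse)
    qed (simp add: zero_mem)
    then have "x + c * (z / c) \<in> U" using c by blast
    then show ?thesis using c by (simp add: z_def)
  qed
  then show "\<exists>\<epsilon>>0. {y. level_abs (y - x) < \<epsilon>} \<subseteq> U" by (intro exI[of _ \<epsilon>]) (auto simp: \<epsilon>_def)
next
  fix U x assume "\<exists>\<epsilon>>0. {y. level_abs (y - x) < \<epsilon>} \<subseteq> U"
  then obtain \<epsilon> where \<epsilon>: "\<epsilon> > 0" "{y. level_abs (y - x) < \<epsilon>} \<subseteq> U" by blast
  \<comment> \<open>Elements of \<open>e powi p * A\<close> have level at most \<open>- p\<close>,
    hence stable level at most \<open>2 - p\<close>; the 3 makes this strictly less than
    \<open>5 * log 2 \<epsilon>\<close>.\<close>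
  define p where "p = \<lceil>3 - 5 * log 2 \<epsilon>\<rceil>"
  have "level_abs (e powi p * a) < \<epsilon>" if a: "a \<in> A" for a
  proof (cases "a = 0")
    case False
    then have nz: "e powi p * a \<noteq> 0" using e0 by simp
    have "e powi (- p) * (e powi p * a) = a" using e0 by (simp add: power_int_minus)
    then have "e powi (- p) * (e powi p * a) \<in> A" using a by (simp only:)
    then have "level (e powi p * a) \<le> - p" using level_le_iff[OF nz] by blast
    then have "stable_level (e powi p * a) \<le> 2 - p" using approx_level_tendsto(2)[OF nz] by linarith
    moreover have "2 - real_of_int p < 5 * log 2 \<epsilon>" unfolding p_def by linarith
    ultimately have "stable_level (e powi p * a) / 5 < log 2 \<epsilon>" by simp
    moreover have "y < log 2 \<epsilon> \<longleftrightarrow> 2 powr y < \<epsilon>" for y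
      using less_log_iff[of 2 \<epsilon> y] \<epsilon>(1) by simp
    ultimately have "2 powr (stable_level (e powi p * a) / 5) < \<epsilon>" by blast
    then show ?thesis using nz \<epsilon>(1) by (simp add: level_abs_def)
  qed (simp add: level_abs_def \<epsilon>)
  then have "\<forall>a\<in>A. x + e powi p * a \<in> U" using \<epsilon>(2) by auto
  then show "\<exists>c. c \<noteq> 0 \<and> (\<forall>a\<in>A. x + c * a \<in> U)" using e0 by (intro exI[of _ "e powi p"]) auto
qed

end

context V_ball
begin

theorem V_topology_ball_topology: "V_topology (ball_topology A)"
proof -
  obtain e where e: "e \<noteq> 0" "\<forall>a\<in>A. \<forall>b\<in>A. e * (a + b) \<in> A \<and> e * (a * b) \<in> A"
    using ball_scalar by blast
  interpret scaled_V_ball A e by standard (use e in auto)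
  show ?thesis
  proof (cases "bd (range (\<lambda>k. inverse e ^ k))")
    case True
    then show ?thesis by (rule V_topology_if_bounded_powers)
  next
    case False
    then interpret archimedean_V_ball A e by unfold_locales
    interpret quasi_absolute_value level_abs by (rule quasi_absolute_value_level_abs)
    show ?thesis unfolding V_topology_def nontrivial_absolute_value_def
      using field_topology_ball_topology absolute_value nontrivial_level_abs induced_by_level_abs by blast
  qed
qed

end

section \<open>V-topological coarsenings\<close>


text \<open>The ball is the valuation ring. Its closure under products is recorded because the
  uniqueness proof extracts \<open>n\<close>-th roots in it.\<close>

lemma V_ball_of_valuation:
  assumes v: "nontrivial_valuation G r (v :: 'k::field \<Rightarrow> 'g)" and ind: "induced_by_valuation G r v \<sigma>"
  shows "\<exists>A. V_ball A \<and> (\<forall>a\<in>A. \<forall>b\<in>A. a * b \<in> A) \<and> \<sigma> = ball_topology A"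
proof -
  have group: "comm_group G" and lin: "linear_order_on (carrier G) r"
    and mono: "\<And>a b c. \<lbrakk>a \<in> carrier G; b \<in> carrier G; c \<in> carrier G; (a, b) \<in> r\<rbrakk>
        \<Longrightarrow> (a \<otimes>\<^bsub>G\<^esub> c, b \<otimes>\<^bsub>G\<^esub> c) \<in> r"
    and img: "v ` (UNIV - {0}) = carrier G"
    and hom: "\<And>x y. x \<noteq> 0 \<Longrightarrow> y \<noteq> 0 \<Longrightarrow> v (x * y) = v x \<otimes>\<^bsub>G\<^esub> v y"
    and ultra: "\<And>x y. \<lbrakk>x \<noteq> 0; y \<noteq> 0; x + y \<noteq> 0\<rbrakk> \<Longrightarrow> (v x, v (x + y)) \<in> r \<or> (v y, v (x + y)) \<in> r"
    and nontriv: "\<exists>x. x \<noteq> 0 \<and> v x \<noteq> \<one>\<^bsub>G\<^esub>"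
    using v unfolding nontrivial_valuation_def valuation_def ordered_abelian_group_def by blast+
  interpret G: comm_group G by (rule group)
  have car: "v x \<in> carrier G" if "x \<noteq> 0" for x using img that by blast
  have trans: "(a, b) \<in> r \<Longrightarrow> (b, c) \<in> r \<Longrightarrow> (a, c) \<in> r" for a b c
    using lin unfolding order_on_defs by (meson transD)
  have antisym: "(a, b) \<in> r \<Longrightarrow> (b, a) \<in> r \<Longrightarrow> a = b" for a b
    using lin unfolding order_on_defs by (meson antisymD)
  have total: "(a, b) \<in> r \<or> (b, a) \<in> r" if "a \<in> carrier G" "b \<in> carrier G" for a b
    using lin that unfolding order_on_defs total_on_def refl_on_def by metis
  have shift: "(v (x * z), v (y * z)) \<in> r" if "(v x, v y) \<in> r" "x \<noteq> 0" "y \<noteq> 0" "z \<noteq> 0" for x y z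
    using mono[of "v x" "v y" "v z"] that car hom by simp
  have v1: "v 1 = \<one>\<^bsub>G\<^esub>"
    using hom[of 1 1] G.l_cancel_one[OF car[of 1] car[of 1]] by simp
  define A where "A = {x. x = 0 \<or> (v 1, v x) \<in> r}"
  have Amult: "a * b \<in> A" if "a \<in> A" "b \<in> A" for a b
  proof (cases "a = 0 \<or> b = 0")
    case True then show ?thesis by (auto simp: A_def)
  next
    case False
    then have 1: "(v 1, v a) \<in> r" "(v 1, v b) \<in> r" using that by (auto simp: A_def)
    then have "(v (1 * b), v (a * b)) \<in> r" using False by (intro shift) auto
    then have "(v 1, v (a * b)) \<in> r" using trans[OF 1(2)] by simp
    then show ?thesis by (simp add: A_def)
  qed
  have Ainv: "inverse x \<in> A" if "x \<notin> A" for x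
  proof -
    have "x \<noteq> 0" "(v 1, v x) \<notin> r" using that by (auto simp: A_def)
    then have "(v x, v 1) \<in> r" using total[OF car[of x] car[of 1]] by simp
    then have "(v (x * inverse x), v (1 * inverse x)) \<in> r" using \<open>x \<noteq> 0\<close> by (intro shift) auto
    then show ?thesis using \<open>x \<noteq> 0\<close> by (simp add: A_def)
  qed
  have Aadd: "a + b \<in> A" if "a \<in> A" "b \<in> A" for a b
  proof (cases "a = 0 \<or> b = 0 \<or> a + b = 0")
    case True then show ?thesis using that by (auto simp: A_def)
  next
    case False
    then have "(v 1, v a) \<in> r" "(v 1, v b) \<in> r" using that by (auto simp: A_def)
    then have "(v 1, v (a + b)) \<in> r" using ultra[of a b] False trans[of "v 1" "v a"] trans[of "v 1" "v b"] by metis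
    then show ?thesis by (simp add: A_def)
  qed
  have m1: "- 1 \<in> A" using Ainv[of "- 1"] by auto
  \<comment> \<open>An element of positive value; the factor \<open>p\<close> moves the closed ball
    \<open>g A\<close> into the open ball of radius \<open>v g\<close>.\<close>
  obtain p where p: "p \<noteq> 0" "p \<in> A" "v p \<noteq> \<one>\<^bsub>G\<^esub>"
  proof -
    obtain x where x: "x \<noteq> 0" "v x \<noteq> \<one>\<^bsub>G\<^esub>" using nontriv by blast
    show thesis
    proof (cases "x \<in> A")
      case True then show ?thesis using that x by blast
    next
      case False
      have "v (inverse x) \<noteq> \<one>\<^bsub>G\<^esub>"
      proof
        assume "v (inverse x) = \<one>\<^bsub>G\<^esub>"
        then have "v (x * inverse x) = v x" using x hom[of x "inverse x"] car by simp
        then show False using x v1 by simp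
      qed
      then show ?thesis using that[of "inverse x"] x Ainv[OF False] by simp
    qed
  qed
  have pA: "v (p * a) \<noteq> v 1" if a: "a \<in> A" "a \<noteq> 0" for a
  proof
    assume "v (p * a) = v 1"
    moreover have "(v (1 * p), v (a * p)) \<in> r" using a p by (intro shift) (auto simp: A_def)
    ultimately have "(v p, v 1) \<in> r" by (simp add: mult.commute)
    moreover have "(v 1, v p) \<in> r" using p by (auto simp: A_def)
    ultimately have "v p = v 1" by (rule antisym)
    then show False using p v1 by simp
  qed
  have "inverse p \<notin> A"
  proof
    assume "inverse p \<in> A"
    then show False using pA[of "inverse p"] p by simp
  qed
  interpret A: V_ball A
  proof
    show "- a \<in> A" if "a \<in> A" for a using Amult[OF m1 that] by simp
    show "A \<noteq> UNIV" using \<open>inverse p \<notin> A\<close> by blast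
  qed (use Aadd Amult Ainv in \<open>auto intro: exI[of _ 1]\<close>)
  have "openin \<sigma> U \<longleftrightarrow> openin (ball_topology A) U" for U
    unfolding ind[unfolded induced_by_valuation_def, rule_format] A.openin_ball_topology'
  proof (intro ball_cong refl iffI)
    fix x assume "\<exists>\<gamma>\<in>carrier G. valuation_ball r v x \<gamma> \<subseteq> U"
    then obtain g where g: "g \<noteq> 0" "valuation_ball r v x (v g) \<subseteq> U" using img by force
    have "x + g * p * a \<in> U" if a: "a \<in> A" for a
    proof (cases "a = 0")
      case True
      then show ?thesis using g(2) by (auto simp: valuation_ball_def)
    next
      case False
      have "p * a \<in> A" using Amult p a by blast
      then have "(v (1 * g), v (p * a * g)) \<in> r" using False p g by (intro shift) (auto simp: A_def)
      moreover have "v g \<noteq> v (p * a * g)"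
      proof
        assume "v g = v (p * a * g)"
        then have "v (p * a) \<otimes>\<^bsub>G\<^esub> v g = v 1 \<otimes>\<^bsub>G\<^esub> v g" using hom[of "p * a" g] v1 car False p g by simp
        then have "v (p * a) = v 1" using car[of "p * a"] car[of g] car[of 1] False p g by simp
        then show False using pA[OF a False] by blast
      qed
      ultimately have "x + g * p * a \<in> valuation_ball r v x (v g)"
        unfolding valuation_ball_def by (simp add: mult_ac)
      then show ?thesis using g(2) by blast
    qed
    then show "\<exists>c. c \<noteq> 0 \<and> (\<forall>a\<in>A. x + c * a \<in> U)" using g(1) p(1) by (intro exI[of _ "g * p"]) auto
  next
    fix x assume "\<exists>c. c \<noteq> 0 \<and> (\<forall>a\<in>A. x + c * a \<in> U)"
    then obtain c where c: "c \<noteq> 0" "\<forall>a\<in>A. x + c * a \<in> U" by blast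
    have "y \<in> U" if y: "y \<in> valuation_ball r v x (v c)" for y
    proof -
      have "(y - x) / c \<in> A"
      proof (cases "y = x")
        case True then show ?thesis by (simp add: A_def)
      next
        case False
        then have "(v c, v (y - x)) \<in> r" using y by (simp add: valuation_ball_def)
        then have "(v (c * inverse c), v ((y - x) * inverse c)) \<in> r"
          using False c(1) by (intro shift) auto
        then show ?thesis using c(1) by (simp add: A_def divide_inverse)
      qed
      then have "x + c * ((y - x) / c) \<in> U" using c by blast
      then show ?thesis using c(1) by simp
    qed
    then show "\<exists>\<gamma>\<in>carrier G. valuation_ball r v x \<gamma> \<subseteq> U" using car[OF c(1)] by blast
  qed
  then have "\<sigma> = ball_topology A" by (simp add: topology_eq)
  then show ?thesis using A.V_ball_axioms Amult by blast
qed

lemma V_ball_of_absolute_value: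
  assumes f: "nontrivial_absolute_value f" and ind: "induced_by_absolute_value f (\<sigma> :: 'k::field topology)"
  shows "\<exists>A. V_ball A \<and> (\<forall>a\<in>A. \<forall>b\<in>A. a * b \<in> A) \<and> \<sigma> = ball_topology A"
proof -
  have nonneg: "\<And>x. f x \<ge> 0" and zero: "\<And>x. f x = 0 \<longleftrightarrow> x = 0" and mult: "\<And>x y. f (x * y) = f x * f y"
    and tri: "\<And>x y. f (x + y) \<le> f x + f y" and nontriv: "\<exists>x. x \<noteq> 0 \<and> f x \<noteq> 1"
    using f unfolding nontrivial_absolute_value_def absolute_value_def by blast+
  have f1: "f 1 = 1" using mult[of 1 1] zero[of 1] by simp
  have finv: "f (inverse x) = inverse (f x)" for x
  proof (cases "x = 0")
    case True
    then show ?thesis using zero[of 0] by simp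
  next
    case False
    then have "f x * f (inverse x) = 1" using mult[of x "inverse x"] f1 by simp
    then show ?thesis by (metis inverse_unique)
  qed
  have fpow: "f (x ^ k) = f x ^ k" for x k by (induction k) (simp_all add: f1 mult)
  define A where "A = {x. f x \<le> 1}"
  have Amult: "a * b \<in> A" if "a \<in> A" "b \<in> A" for a b
    using that mult_mono[of "f a" 1 "f b" 1] nonneg by (simp add: A_def mult)
  have Ainv: "inverse x \<in> A" if "x \<notin> A" for x
    using that by (simp add: A_def finv inverse_le_1_iff)
  have m1: "- 1 \<in> A" using Ainv[of "- 1"] by auto
  obtain p where p: "p \<noteq> 0" "f p < 1"
  proof -
    obtain x where x: "x \<noteq> 0" "f x \<noteq> 1" using nontriv by blast
    have "f x < 1 \<or> f (inverse x) < 1"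
      using x zero[of x] nonneg[of x] by (auto simp: finv inverse_less_1_iff)
    then show thesis using that[of x] that[of "inverse x"] x by auto
  qed
  have small: "\<exists>c. c \<noteq> 0 \<and> f c < \<epsilon>" if \<epsilon>: "\<epsilon> > 0" for \<epsilon>
  proof -
    obtain k where "f p ^ k < \<epsilon>" using real_arch_pow_inv[OF \<epsilon> p(2)] by blast
    then show ?thesis using p(1) by (intro exI[of _ "p ^ k"]) (simp add: fpow)
  qed
  have "inverse p \<notin> A"
    using p zero[of p] nonneg[of p] by (simp add: A_def finv inverse_le_1_iff)
  interpret A: V_ball A
  proof
    show "- a \<in> A" if "a \<in> A" for a using Amult[OF m1 that] by simp
    show "A \<noteq> UNIV" using \<open>inverse p \<notin> A\<close> by blast
    \<comment> \<open>A sum of two elements of the unit ball has value at most 2; the scalar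
      \<open>c\<close> brings it back.\<close>
    obtain c where c: "c \<noteq> 0" "f c < 1 / 2" using small[of "1 / 2"] by auto
    have "c * (a + b) \<in> A" if "a \<in> A" "b \<in> A" for a b
    proof -
      have "f (a + b) \<le> 2" using tri[of a b] that by (simp add: A_def)
      then have "f c * f (a + b) \<le> 1 / 2 * 2" using c nonneg by (intro mult_mono) auto
      then show ?thesis by (simp add: A_def mult)
    qed
    then show "\<exists>d. d \<noteq> 0 \<and> (\<forall>a\<in>A. \<forall>b\<in>A. d * (a + b) \<in> A)" using c by blast
  qed (use Amult Ainv in \<open>auto intro: exI[of _ 1]\<close>)
  have "openin \<sigma> U \<longleftrightarrow> openin (ball_topology A) U" for U
    unfolding ind[unfolded induced_by_absolute_value_def, rule_format] A.openin_ball_topology'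
  proof (intro ball_cong refl iffI)
    fix x assume "\<exists>\<epsilon>>0. {y. f (y - x) < \<epsilon>} \<subseteq> U"
    then obtain \<epsilon> where \<epsilon>: "\<epsilon> > 0" "{y. f (y - x) < \<epsilon>} \<subseteq> U" by blast
    obtain c where c: "c \<noteq> 0" "f c < \<epsilon>" using small[OF \<epsilon>(1)] by blast
    have "x + c * a \<in> U" if "a \<in> A" for a
    proof -
      have "f c * f a \<le> f c * 1" using that nonneg by (intro mult_left_mono) (auto simp: A_def)
      then have "f (x + c * a - x) < \<epsilon>" using c by (simp add: mult)
      then show ?thesis using \<epsilon>(2) by blast
    qed
    then show "\<exists>c. c \<noteq> 0 \<and> (\<forall>a\<in>A. x + c * a \<in> U)" using c(1) by blast
  next
    fix x assume "\<exists>c. c \<noteq> 0 \<and> (\<forall>a\<in>A. x + c * a \<in> U)"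
    then obtain c where c: "c \<noteq> 0" "\<forall>a\<in>A. x + c * a \<in> U" by blast
    have fc: "f c > 0" using c(1) zero[of c] nonneg[of c] by simp
    have "y \<in> U" if y: "f (y - x) < f c" for y
    proof -
      have "f ((y - x) / c) = f (y - x) / f c" by (simp add: divide_inverse mult finv)
      then have "(y - x) / c \<in> A" using y fc by (simp add: A_def)
      then have "x + c * ((y - x) / c) \<in> U" using c by blast
      then show ?thesis using c(1) by simp
    qed
    then show "\<exists>\<epsilon>>0. {y. f (y - x) < \<epsilon>} \<subseteq> U" using fc by (intro exI[of _ "f c"]) auto
  qed
  then have "\<sigma> = ball_topology A" by (simp add: topology_eq)
  then show ?thesis using A.V_ball_axioms Amult by blast
qed

lemma V_topology_imp_V_ball:
  assumes "V_topology (\<sigma> :: 'k::field topology)"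
  shows "\<exists>A. V_ball A \<and> (\<forall>a\<in>A. \<forall>b\<in>A. a * b \<in> A) \<and> \<sigma> = ball_topology A"
proof -
  consider (val) G :: "'k set monoid" and r v where "nontrivial_valuation G r v" "induced_by_valuation G r v \<sigma>"
    | (abs) f where "nontrivial_absolute_value f" "induced_by_absolute_value f \<sigma>"
    using assms unfolding V_topology_def by blast
  then show ?thesis by cases (blast dest: V_ball_of_valuation V_ball_of_absolute_value)+
qed

lemma local_W_topology_imp_local_weight:
  assumes "local_W_topology \<tau>"
  shows "\<exists>A S n. local_weight A S n \<and> \<tau> = ball_topology A"
proof -
  obtain n S where n: "lb_ring_topology \<tau>" "bounded_in \<tau> S" "W_set n S"
    using assms unfolding local_W_topology_def W_topology_def W_n_topology_def by blast
  obtain A where A: "lb_ball A" "\<tau> = ball_topology A" using lb_ring_topology_imp_ball[OF n(1)] by blast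
  interpret lb_ball A by (rule A(1))
  have "local_weight A S n"
  proof unfold_locales
    show "bd S" using n(2) by (simp add: A(2) bounded_in_ball_topology)
    show "W_set n S" by (rule n(3))
    fix B assume "bd B"
    then obtain C where C: "bd C"
      "\<forall>x\<in>B. (x \<noteq> 0 \<and> 1 / x \<in> C) \<or> (1 - x \<noteq> 0 \<and> 1 / (1 - x) \<in> C)"
      using assms unfolding local_W_topology_def A(2) bounded_in_ball_topology by blast
    have "\<exists>c\<in>C. x * c = 1 \<or> (1 - x) * c = 1" if x: "x \<in> B" for x
    proof -
      consider "x \<noteq> 0" "1 / x \<in> C" | "1 - x \<noteq> 0" "1 / (1 - x) \<in> C" using C(2) x by blast
      then show ?thesis
      proof cases
        case 1 then show ?thesis by (intro bexI[of _ "1 / x"]) simp_all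
      next
        case 2 then show ?thesis by (intro bexI[of _ "1 / (1 - x)"]) simp_all
      qed
    qed
    then show "\<exists>C. bd C \<and> (\<forall>x\<in>B. \<exists>c\<in>C. x * c = 1 \<or> (1 - x) * c = 1)" using C(1) by blast
  qed
  then show ?thesis using A(2) by blast
qed

section \<open>Existence and uniqueness of the V-topological coarsening\<close>

context local_weight
begin

text \<open>The set \<open>B\<close> of the dichotomy is enlarged to a ball \<open>K\<close>, which
  keeps the dichotomy and is moreover a neighbourhood. Scalars then map the bounded sets
  \<open>K + K\<close> and \<open>K * K\<close> into \<open>K\<close>, and
  \<open>thick_scale\<close> carries this over to \<open>thick K\<close>.\<close>

lemma ex_V_ball: "\<exists>c. c \<noteq> 0 \<and> V_ball (thick ((*) c ` A))"
proof -
  obtain B where B: "bd B" "\<And>e. e \<in> thick B \<or> inverse e \<in> thick B" using thick_dichotomy by blast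
  obtain c where c: "c \<noteq> 0" "B \<subseteq> (*) c ` A" using B(1) unfolding bd_iff_ball by blast
  define K where "K = (*) c ` A"
  have K: "bd K" "nb K" unfolding K_def using bd_ball nb_ball[OF c(1)] by auto
  have scaled: "f * e \<in> thick K" if e: "e \<in> thick X" and f: "\<forall>x\<in>X. f * x \<in> K" for e f X
    using thick_scale[OF e, of f] thick_mono[of "(*) f ` X" K] f by blast
  have "V_ball (thick K)"
  proof
    show "- a \<in> thick K" if "a \<in> thick K" for a
    proof -
      have "- 1 * x \<in> K" if x: "x \<in> K" for x
      proof -
        obtain a where "a \<in> A" "x = c * a" using x unfolding K_def by blast
        then show ?thesis unfolding K_def using neg_mem by (intro image_eqI[of _ _ "- a"]) auto
      qed
      then have "- 1 * a \<in> thick K" by (intro scaled[OF that]) blast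
      then show ?thesis by simp
    qed
    obtain d where d: "d \<noteq> 0" "\<forall>x\<in>K + K. d * x \<in> K"
      using scale_into[OF K(2) bd_plus[OF K(1) K(1)]] by blast
    show "\<exists>d. d \<noteq> 0 \<and> (\<forall>a\<in>thick K. \<forall>b\<in>thick K. d * (a + b) \<in> thick K)"
      using d scaled thick_plus[OF K(1) K(1)] by blast
    obtain d where d: "d \<noteq> 0" "\<forall>x\<in>K * K. d * x \<in> K"
      using scale_into[OF K(2) bd_times[OF K(1) K(1)]] by blast
    show "\<exists>d. d \<noteq> 0 \<and> (\<forall>a\<in>thick K. \<forall>b\<in>thick K. d * (a * b) \<in> thick K)"
      using d scaled thick_times[OF K(1) K(1)] by blast
    show "inverse x \<in> thick K" if "x \<notin> thick K" for x
      using that B(2)[of x] thick_mono[OF c(2)] unfolding K_def by blast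
    show "thick K \<noteq> UNIV" by (rule thick_proper[OF K(1)])
  qed
  then show ?thesis using c(1) unfolding K_def by blast
qed

lemma coarsening_thick:
  assumes "c \<noteq> 0" "V_ball (thick ((*) c ` A))"
  shows "coarsening (ball_topology (thick ((*) c ` A))) (ball_topology A)"
proof -
  interpret D: V_ball "thick ((*) c ` A)" by (rule assms(2))
  show ?thesis unfolding coarsening_def D.openin_ball_topology openin_ball_topology
  proof (intro allI impI ballI)
    fix U x assume "\<forall>x\<in>U. D.nb {y. x + y \<in> U}" "x \<in> U"
    then obtain d where d: "d \<noteq> 0" "\<forall>a\<in>thick ((*) c ` A). d * a \<in> {y. x + y \<in> U}"
      unfolding D.nb_def by blast
    have "d * c * a \<in> {y. x + y \<in> U}" if "a \<in> A" for a
    proof -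
      have "c * a \<in> thick ((*) c ` A)" using that subset_thick by blast
      then show ?thesis using d(2) by (metis mult.assoc)
    qed
    then show "nb {y. x + y \<in> U}" unfolding nb_def using d(1) assms(1)
      by (intro exI[of _ "d * c"]) auto
  qed
qed

text \<open>Let \<open>E\<close> be a product-closed ball of the coarsening. It is a neighbourhood
  of zero also in the finer topology, so an element of \<open>D\<close> is a point of
  \<open>c A\<close> plus an error with \<open>n\<close>-th power in \<open>E\<close>. Both summands
  are bounded for \<open>E\<close>; thus \<open>D\<close> lies in a multiple of \<open>E\<close>.
  The dichotomy for \<open>D\<close> gives the converse.\<close>

lemma V_topology_coarsening_unique:
  assumes c: "c \<noteq> 0" "V_ball (thick ((*) c ` A))"
    and \<sigma>: "V_topology \<sigma>" "coarsening \<sigma> (ball_topology A)"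
  shows "\<sigma> = ball_topology (thick ((*) c ` A))"
proof -
  define D where "D = thick ((*) c ` A)"
  interpret D: V_ball D unfolding D_def by (rule c(2))
  obtain E where E: "V_ball E" "\<And>a b. a \<in> E \<Longrightarrow> b \<in> E \<Longrightarrow> a * b \<in> E" "\<sigma> = ball_topology E"
    using V_topology_imp_V_ball[OF \<sigma>(1)] by metis
  interpret E: V_ball E by (rule E(1))
  have E_power: "x ^ k \<in> E" if "x \<in> E" for x k
    by (induction k) (use that E(2) E.one_mem in auto)
  \<comment> \<open>If \<open>x\<close> is not in \<open>E\<close>, then \<open>1/x\<close> is, and
    \<open>x = x ^ n * inverse x ^ (n - 1)\<close> is a product of elements of
    \<open>E\<close>.\<close>
  have root: "x \<in> E" if x: "x ^ n \<in> E" for x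
  proof (rule ccontr)
    assume "x \<notin> E"
    then have "x \<noteq> 0" "inverse x \<in> E" using E.zero_mem E.inv by auto
    then have "x ^ n * inverse x ^ (n - 1) \<in> E" using E(2) x E_power by blast
    moreover have "x ^ n * inverse x ^ (n - 1) = x"
    proof -
      have "x ^ n = x * x ^ (n - 1)" using n_pos by (simp add: power_eq_if)
      then show ?thesis using \<open>x \<noteq> 0\<close> by (simp add: power_inverse)
    qed
    ultimately show False using \<open>x \<notin> E\<close> by simp
  qed
  have "nbhd_zero \<sigma> E" by (simp add: E(3) E.nbhd_zero_ball_topology E.nb_A)
  then have "nbhd_zero (ball_topology A) E"
    using \<sigma>(2) unfolding nbhd_zero_def coarsening_def by blast
  then have nbE: "nb E" by (simp add: nbhd_zero_ball_topology)
  then obtain f where f: "f \<noteq> 0" "\<forall>a\<in>A. f * a \<in> E" unfolding nb_def by blast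
  have "E.bd ((*) (c / f) ` E + E)" by (intro E.bd_plus E.bd_ball E.bd_A)
  then obtain g where g: "g \<noteq> 0" "\<forall>x\<in>(*) (c / f) ` E + E. g * x \<in> E" unfolding E.bd_def by blast
  have DE: "g * e \<in> E" if e: "e \<in> D" for e
  proof -
    obtain s where s: "s \<in> (*) c ` A" "(e - s) ^ n \<in> E" using thickD[OF _ nbE] e unfolding D_def by blast
    obtain a where a: "a \<in> A" "s = c * a" using s(1) by blast
    have "s = c / f * (f * a)" using a f by simp
    then have "s \<in> (*) (c / f) ` E" using a f by blast
    then have "s + (e - s) \<in> (*) (c / f) ` E + E" using root[OF s(2)] by (rule set_plus_intro)
    then show ?thesis using g by simp
  qed
  obtain y where y: "y \<notin> E" using E.proper by blast
  then have y0: "y \<noteq> 0" using E.zero_mem by blast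
  \<comment> \<open>Otherwise the inverse of \<open>g / y * x\<close> is in \<open>D\<close>.
    Multiplication by \<open>g\<close> and then by \<open>x\<close> stays in \<open>E\<close> and
    yields \<open>y\<close>, which was chosen outside \<open>E\<close>.\<close>
  have ED: "g / y * x \<in> D" if x: "x \<in> E" for x
  proof (rule ccontr)
    assume *: "g / y * x \<notin> D"
    then have "x \<noteq> 0" using D.zero_mem by auto
    have "g * inverse (g / y * x) \<in> E" using DE D.inv[OF *] by blast
    then have "g * inverse (g / y * x) * x \<in> E" using E(2) x by blast
    then show False using y g(1) \<open>x \<noteq> 0\<close> by simp
  qed
  have "ball_topology D = ball_topology E"
    using DE ED g(1) y0 by (intro ball_topology_cong[of g _ _ "g / y"]) auto
  then show ?thesis by (simp add: E(3) D_def)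
qed

lemma ex1_V_topology_coarsening: "\<exists>!\<sigma>. V_topology \<sigma> \<and> coarsening \<sigma> (ball_topology A)"
proof -
  obtain c where c: "c \<noteq> 0" "V_ball (thick ((*) c ` A))" using ex_V_ball by blast
  show ?thesis
    using V_ball.V_topology_ball_topology[OF c(2)] coarsening_thick[OF c] V_topology_coarsening_unique[OF c]
    by blast
qed

end

subsection \<open>The induced ring\<close>

locale elementary_star =
  fixes star :: "'k::field set \<Rightarrow> 'm::field set" and \<iota> :: "'k \<Rightarrow> 'm"
  assumes elementary: "elementary_embedding (\<lambda>U. U) star \<iota>"
begin

text \<open>Only closed formulas are transferred below, so one fixed assignment suffices.\<close>

lemma transfer: "holds (\<lambda>U. U) (\<lambda>_. 0) \<phi> \<longleftrightarrow> holds star (\<lambda>_. \<iota> 0) \<phi>"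
  using elementary unfolding elementary_embedding_def by (simp add: o_def)

lemma star_zero: "0 \<in> X \<Longrightarrow> 0 \<in> star X"
  using transfer[of "FPred X TZero"] by simp

lemma star_one: "1 \<in> X \<Longrightarrow> 1 \<in> star X"
  using transfer[of "FPred X TOne"] by simp

lemma star_binary:
  assumes "\<And>x y. x \<in> X \<Longrightarrow> y \<in> Y \<Longrightarrow> x + y \<in> Z \<and> x - y \<in> Z \<and> x * y \<in> Z" "x \<in> star X" "y \<in> star Y"
  shows "x + y \<in> star Z \<and> x - y \<in> star Z \<and> x * y \<in> star Z"
proof -
  define \<phi> where "\<phi> t = FNot (FEx 0 (FEx 1 (FAnd (FAnd (FPred X (TVar 0)) (FPred Y (TVar 1)))
      (FNot (FPred Z t)))))" for t
  have "holds (\<lambda>U. U) (\<lambda>_. 0) (\<phi> (TPlus (TVar 0) (TVar 1)))"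
    "holds (\<lambda>U. U) (\<lambda>_. 0) (\<phi> (TMinus (TVar 0) (TVar 1)))"
    "holds (\<lambda>U. U) (\<lambda>_. 0) (\<phi> (TTimes (TVar 0) (TVar 1)))"
    using assms(1) by (auto simp: \<phi>_def)
  then have "holds star (\<lambda>_. \<iota> 0) (\<phi> (TPlus (TVar 0) (TVar 1)))"
    "holds star (\<lambda>_. \<iota> 0) (\<phi> (TMinus (TVar 0) (TVar 1)))"
    "holds star (\<lambda>_. \<iota> 0) (\<phi> (TTimes (TVar 0) (TVar 1)))"
    by (simp_all only: transfer)
  then show ?thesis using assms(2,3) by (auto simp: \<phi>_def)
qed

lemma star_quotient:
  assumes "\<And>x. \<exists>c. c \<noteq> 0 \<and> c \<in> X \<and> x * c \<in> X"
  shows "\<forall>x. \<exists>c. c \<noteq> 0 \<and> c \<in> star X \<and> x * c \<in> star X"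
  using transfer[of "FNot (FEx 0 (FNot (FEx 1 (FAnd (FNot (FEq (TVar 1) TZero))
    (FAnd (FPred X (TVar 1)) (FPred X (TTimes (TVar 0) (TVar 1))))))))"] assms
  by (simp add: conj_ac)

text \<open>The language has no symbol for the inverse, so it is expressed by a witness
  \<open>y\<close> with \<open>x * y = 1\<close>.\<close>

lemma star_dichotomy:
  assumes "\<And>x. x \<in> X \<or> (\<exists>y. x * y = 1 \<and> y \<in> X)"
  shows "x \<in> star X \<or> (\<exists>y. x * y = 1 \<and> y \<in> star X)"
  using transfer[of "FNot (FEx 0 (FAnd (FNot (FPred X (TVar 0)))
    (FNot (FEx 1 (FAnd (FEq (TTimes (TVar 0) (TVar 1)) TOne) (FPred X (TVar 1)))))))"] assms by auto

lemma star_approx_root: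
  assumes "\<And>x. x \<in> X \<Longrightarrow> \<exists>s\<in>Y. (x - s) ^ n \<in> Z" "x \<in> star X"
  shows "\<exists>s\<in>star Y. (x - s) ^ n \<in> star Z"
proof -
  \<comment> \<open>The exponent is a fixed number, so the power is an iterated product
    term.\<close>
  define t where "t = ((\<lambda>u. TTimes (TMinus (TVar 0) (TVar 1)) u) ^^ n) TOne"
  have t: "rterm_eval e t = (e 0 - e 1) ^ n" for e :: "nat \<Rightarrow> 'z::field"
    unfolding t_def by (induction n) simp_all
  show ?thesis
    using transfer[of "FNot (FEx 0 (FAnd (FPred X (TVar 0))
      (FNot (FEx 1 (FAnd (FPred Y (TVar 1)) (FPred Z t))))))"] assms by (auto simp: t)
qed

lemma subring_star_bounded:
  assumes "lb_ball A"
  shows "subring_of_field (\<Union>{star X | X. lb_ball.bd A X})"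
proof -
  interpret lb_ball A by (rule assms)
  let ?R = "\<Union>{star X | X. bd X}"
  have "0 \<in> ?R" "1 \<in> ?R"
    using bd_A star_zero[OF zero_mem] star_one[OF one_mem] by blast+
  moreover have "x + y \<in> ?R \<and> x - y \<in> ?R \<and> x * y \<in> ?R" if xy: "x \<in> ?R" "y \<in> ?R" for x y
  proof -
    obtain X Y where X: "bd X" "x \<in> star X" and Y: "bd Y" "y \<in> star Y" using xy by blast
    define Z where "Z = (X + Y) \<union> {x - y | x y. x \<in> X \<and> y \<in> Y} \<union> X * Y"
    have "bd Z" unfolding Z_def by (intro bd_Un bd_plus bd_diff bd_times X Y)
    moreover have "x + y \<in> star Z \<and> x - y \<in> star Z \<and> x * y \<in> star Z"
      by (rule star_binary[OF _ X(2) Y(2)]) (auto simp: Z_def)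
    ultimately show ?thesis by blast
  qed
  ultimately show ?thesis unfolding subring_of_field_def by blast
qed

end

section \<open>Integral closure\<close>

lemma subring_power:
  assumes "subring_of_field V" "x \<in> V" shows "x ^ k \<in> V"
  by (induction k) (use assms in \<open>auto simp: subring_of_field_def\<close>)

lemma subring_sum:
  assumes "subring_of_field V" "\<And>i. i \<in> I \<Longrightarrow> f i \<in> V" shows "sum f I \<in> V"
  using assms(2)
  by (induction I rule: infinite_finite_induct) (use assms(1) in \<open>auto simp: subring_of_field_def\<close>)

lemma subring_uminus: 
  assumes "subring_of_field V" "x \<in> V" shows "- x \<in> V"
proof -
  have "0 - x \<in> V" using assms unfolding subring_of_field_def by blast
  then show ?thesis by simp
qed

text \<open>If \<open>x\<close> is not in \<open>V\<close>, then \<open>1/x\<close> is. Dividing the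
  monic equation of degree \<open>N\<close> by \<open>x ^ (N - 1)\<close> writes \<open>x\<close> as
  a polynomial in \<open>1/x\<close> over \<open>V\<close>.\<close>

lemma valuation_ring_integrally_closed:
  assumes V: "valuation_ring V" and p: "lead_coeff p = 1" "\<And>i. coeff p i \<in> V" "poly p x = 0"
  shows "x \<in> V"
proof (rule ccontr)
  assume "x \<notin> V"
  have sub: "subring_of_field V" using V unfolding valuation_ring_def by blast
  have x0: "x \<noteq> 0" using \<open>x \<notin> V\<close> sub unfolding subring_of_field_def by blast
  then have y: "inverse x \<in> V" using V \<open>x \<notin> V\<close> unfolding valuation_ring_def by blast
  define N where "N = degree p"
  have "N > 0"
  proof (rule ccontr)
    assume "\<not> N > 0"
    then obtain a where "p = [:a:]" by (auto simp: N_def elim: degree_eq_zeroE)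
    then show False using p(1,3) by simp
  qed
  have "0 = (\<Sum>i\<le>N. coeff p i * x ^ i)" using p(3) by (simp add: poly_altdef N_def)
  also have "\<dots> = (\<Sum>i<N. coeff p i * x ^ i) + x ^ N"
    using p(1) by (simp add: N_def lessThan_Suc_atMost[symmetric])
  finally have "x ^ N = - (\<Sum>i<N. coeff p i * x ^ i)" by (simp add: eq_neg_iff_add_eq_0 add.commute)
  then have "x ^ N * inverse x ^ (N - 1) = - (\<Sum>i<N. coeff p i * x ^ i * inverse x ^ (N - 1))"
    by (simp add: sum_distrib_right)
  also have "(\<Sum>i<N. coeff p i * x ^ i * inverse x ^ (N - 1)) = (\<Sum>i<N. coeff p i * inverse x ^ (N - 1 - i))"
  proof (rule sum.cong)
    fix i assume "i \<in> {..<N}"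
    then have "inverse x ^ (N - 1) = inverse x ^ i * inverse x ^ (N - 1 - i)"
      by (simp flip: power_add)
    then show "coeff p i * x ^ i * inverse x ^ (N - 1) = coeff p i * inverse x ^ (N - 1 - i)"
      using x0 by (simp add: power_inverse)
  qed simp
  also have "x ^ N * inverse x ^ (N - 1) = x"
    using \<open>N > 0\<close> x0 by (cases N) (simp_all add: power_inverse)
  finally have eq: "x = - (\<Sum>i<N. coeff p i * inverse x ^ (N - 1 - i))" .
  have "coeff p i * inverse x ^ (N - 1 - i) \<in> V" for i
    using sub p(2) subring_power[OF sub y] unfolding subring_of_field_def by blast
  then have "- (\<Sum>i<N. coeff p i * inverse x ^ (N - 1 - i)) \<in> V"
    by (intro subring_uminus[OF sub] subring_sum[OF sub])
  then have "x \<in> V" by (simp only: eq[symmetric])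
  then show False using \<open>x \<notin> V\<close> by blast
qed

lemma coeff_mult_subring:
  assumes "subring_of_field V" "\<And>i. coeff p i \<in> V" "\<And>i. coeff q i \<in> V"
  shows "coeff (p * q) i \<in> V"
  unfolding coeff_mult
  by (rule subring_sum[OF assms(1)]) (use assms in \<open>auto simp: subring_of_field_def\<close>)

lemma integral_if_approx_root:
  assumes V: "subring_of_field V" and s: "s \<in> V" "(x - s) ^ n \<in> V" and n: "n > 0"
  shows "\<exists>p. lead_coeff p = 1 \<and> (\<forall>i. coeff p i \<in> V) \<and> poly p x = 0"
proof -
  define p where "p = [:- ((x - s) ^ n):] + [:- s, 1:] ^ n"
  have V01: "0 \<in> V" "1 \<in> V" and Vadd: "\<And>x y. x \<in> V \<Longrightarrow> y \<in> V \<Longrightarrow> x + y \<in> V"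
    using V unfolding subring_of_field_def by blast+
  have "coeff ([:- s, 1:] ^ k) i \<in> V" for i k
  proof (induction k arbitrary: i)
    case 0
    then show ?case using V01 by (simp add: coeff_1)
  next
    case (Suc k)
    have "coeff [:- s, 1:] i \<in> V" for i
      using V01 subring_uminus[OF V s(1)] by (auto simp: coeff_pCons split: nat.split)
    then show ?case unfolding power_Suc by (intro coeff_mult_subring[OF V] Suc.IH)
  qed
  moreover have "coeff [:- ((x - s) ^ n):] i \<in> V" for i
    using V01 subring_uminus[OF V s(2)] by (auto simp: coeff_pCons split: nat.split)
  ultimately have "\<forall>i. coeff p i \<in> V" unfolding p_def by (simp add: Vadd)
  moreover have "lead_coeff p = 1"
  proof -
    have "degree [:- ((x - s) ^ n):] < degree ([:- s, 1:] ^ n)" using n by (simp add: degree_linear_power)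
    then have "lead_coeff p = lead_coeff ([:- s, 1:] ^ n)" unfolding p_def by (rule lead_coeff_add_le)
    also have "\<dots> = 1" unfolding lead_coeff_power by simp
    finally show ?thesis .
  qed
  moreover have "poly p x = 0" unfolding p_def by (simp add: poly_power)
  ultimately show ?thesis by blast
qed

context local_weight
begin

text \<open>The closure is identified with the ring \<open>V\<close> induced by the ball
  \<open>D\<close>. It is a valuation ring by transfer of the dichotomy, and it contains
  \<open>R\<close> because sets bounded for \<open>A\<close> are bounded for \<open>D\<close>; being
  integrally closed, it contains the closure of \<open>R\<close>. Conversely, its elements are
  approximate roots.\<close>

lemma induced_ring_integral_closure:
  fixes star :: "'k set \<Rightarrow> 'm::field set"
  assumes "elementary_embedding (\<lambda>U. U) star \<iota>"
  defines "R \<equiv> \<Union>{star X | X. bd X}"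
  shows "fractions R = UNIV" "valuation_ring (integral_closure_in (fractions R) R)"
proof -
  interpret elementary_star star \<iota> by standard (rule assms(1))
  have R: "subring_of_field R" unfolding R_def by (rule subring_star_bounded[OF lb_ball_axioms])
  have "\<exists>c. c \<noteq> 0 \<and> c \<in> A \<and> x * c \<in> A" for x
  proof -
    obtain d where d: "d \<noteq> 0" "\<forall>a\<in>A. d * a \<in> A \<and> d * a * x \<in> A" using dir_ball by blast
    then have "d * 1 \<in> A" "d * 1 * x \<in> A" using one_mem by blast+
    then show ?thesis using d(1) by (intro exI[of _ d]) (simp add: mult.commute)
  qed
  then have q: "\<forall>x. \<exists>c. c \<noteq> 0 \<and> c \<in> star A \<and> x * c \<in> star A" by (rule star_quotient)
  have starA: "star A \<subseteq> R" unfolding R_def using bd_A by blast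
  have "x \<in> fractions R" for x
  proof -
    obtain c where "c \<noteq> 0" "c \<in> star A" "x * c \<in> star A" using q by blast
    then have "x = (x * c) / c" "x * c \<in> R" "c \<in> R" using starA by auto
    then show ?thesis unfolding fractions_def using \<open>c \<noteq> 0\<close> by blast
  qed
  then show frac: "fractions R = UNIV" by blast
  obtain c where c: "c \<noteq> 0" "V_ball (thick ((*) c ` A))" using ex_V_ball by blast
  define D where "D = thick ((*) c ` A)"
  interpret D: V_ball D unfolding D_def by (rule c(2))
  define V where "V = \<Union>{star X | X. D.bd X}"
  have subV: "subring_of_field V" unfolding V_def by (rule subring_star_bounded[OF D.lb_ball_axioms])
  have starD: "star D \<subseteq> V" unfolding V_def using D.bd_A by blast
  have "x \<in> V \<or> inverse x \<in> V" for x
  proof -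
    have "x \<in> D \<or> (\<exists>y. x * y = 1 \<and> y \<in> D)" for x
    proof (cases "x \<in> D")
      case False
      then have "x \<noteq> 0" using D.zero_mem by blast
      then show ?thesis using D.inv[OF False] by (intro disjI2 exI[of _ "inverse x"]) simp
    qed blast
    then have "x \<in> star D \<or> (\<exists>y. x * y = 1 \<and> y \<in> star D)" by (rule star_dichotomy)
    then show ?thesis using starD inverse_unique by blast
  qed
  then have valV: "valuation_ring V" using subV unfolding valuation_ring_def by blast
  have RV: "R \<subseteq> V"
  proof -
    have "D.bd X" if "bd X" for X
    proof -
      obtain d where d: "d \<noteq> 0" "\<forall>x\<in>X. d * x \<in> A" using \<open>bd X\<close> unfolding bd_def by blast
      have "c * d * x \<in> D" if "x \<in> X" for x
      proof -
        have "c * (d * x) \<in> D" using d(2) that subset_thick unfolding D_def by blast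
        then show ?thesis by (simp add: mult.assoc)
      qed
      then show ?thesis unfolding D.bd_def using c(1) d(1) by (intro exI[of _ "c * d"]) auto
    qed
    then show ?thesis unfolding R_def V_def by blast
  qed
  have "integral_closure_in UNIV R = V"
  proof
    show "integral_closure_in UNIV R \<subseteq> V"
      unfolding integral_closure_in_def using valuation_ring_integrally_closed[OF valV] RV by blast
    show "V \<subseteq> integral_closure_in UNIV R"
    proof
      fix x assume "x \<in> V"
      then obtain X where X: "D.bd X" "x \<in> star X" unfolding V_def by blast
      obtain d where d: "d \<noteq> 0" "X \<subseteq> (*) d ` D" using X(1) unfolding D.bd_iff_ball by blast
      define K where "K = (*) d ` (*) c ` A"
      \<comment> \<open>The single neighbourhood \<open>A\<close> is enough here: the power of the
        error has only to be bounded, so that after transfer it lies in \<open>R\<close>.\<close>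
      have "\<exists>s\<in>K. (y - s) ^ n \<in> A" if y: "y \<in> X" for y
      proof -
        obtain z where "z \<in> D" "y = d * z" using d(2) y by blast
        then have "y \<in> thick K" unfolding K_def D_def using thick_scale by blast
        then show ?thesis using thickD[OF _ nb_A] by blast
      qed
      then obtain s where s: "s \<in> star K" "(x - s) ^ n \<in> star A" using star_approx_root X(2) by meson
      have "bd K" using bd_ball[of "d * c"] by (simp add: K_def image_image mult.assoc)
      then have "s \<in> R" "(x - s) ^ n \<in> R" using s starA unfolding R_def by blast+
      then show "x \<in> integral_closure_in UNIV R"
        unfolding integral_closure_in_def using integral_if_approx_root[OF R _ _ n_pos] by blast
    qed
  qed
  then show "valuation_ring (integral_closure_in (fractions R) R)" using valV by (simp add: frac)
qed

end

theorem theorem4p3: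
  fixes \<tau> :: "'k::field topology"
  assumes "local_W_topology \<tau>"
  shows "(\<exists>!\<sigma>. V_topology \<sigma> \<and> coarsening \<sigma> \<tau>) \<and>
    (\<forall>(\<kappa> :: 'c rel) (\<iota> :: 'k \<Rightarrow> 'm::field) (star :: 'k set \<Rightarrow> 'm set).
       monster_extension \<kappa> \<iota> star \<longrightarrow>
       (let R = induced_ring \<tau> star in
          fractions R = UNIV \<and> valuation_ring (integral_closure_in (fractions R) R)))"
proof -
  obtain A S n where A: "local_weight A S n" "\<tau> = ball_topology A"
    using local_W_topology_imp_local_weight[OF assms] by blast
  interpret local_weight A S n by (rule A(1))
  have "induced_ring \<tau> star = \<Union>{star X | X. bd X}" for star :: "'k set \<Rightarrow> 'm set"
    unfolding induced_ring_def A(2) bounded_in_ball_topology ..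
  moreover have "fractions (\<Union>{star X | X. bd X}) = UNIV \<and>
      valuation_ring (integral_closure_in (fractions (\<Union>{star X | X. bd X})) (\<Union>{star X | X. bd X}))"
    if "monster_extension \<kappa> \<iota> star" for \<kappa> :: "'c rel" and \<iota> :: "'k \<Rightarrow> 'm" and star
  proof -
    have "elementary_embedding (\<lambda>U. U) star \<iota>" using that unfolding monster_extension_def by blast
    from induced_ring_integral_closure[OF this] show ?thesis ..
  qed
  moreover have "\<exists>!\<sigma>. V_topology \<sigma> \<and> coarsening \<sigma> \<tau>"
    unfolding A(2) by (rule ex1_V_topology_coarsening)
  ultimately show ?thesis by (simp only: Let_def) blast
qed

end
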